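(* Let $(\star)$ be a linear system over $\mathbb{F}_q$ with coefficient matrix $A\in\mathbb{F}_q^{m\times k}$ which is of type (RC), non-degenerate and irreducible, and let $\ell$ be its number of column equivalence classes. Suppose that at least one of the following holds: (i) none of the column equivalence classes sums to zero, and $\ell=m+1$; (ii) every column equivalence class sums to zero. Then $(\star)$ is temperate.
   Context: Let $\mathbb{F}_q$ be a finite field with $q$ elements. A linear system $(\star)$ with coefficient matrix $A=(a_{ij})\in\mathbb{F}_q^{m\times k}$ is the system $a_{i1}x_1+\cdots+a_{ik}x_k=0$ ($i\in[m]$); a solution is a $k$-tuple $(x_1,\dots,x_k)\in(\mathbb{F}_q^n)^k$ satisfying all of them. A linear equation $b_1x_1+\dots+b_kx_k=0$ ($b\in\mathbb{F}_q^k$) is balanced if $b_1+\dots+b_k=0$; the system is balanced if every row of $A$ sums to $0$. A solution is generic if every balanced linear equation it satisfies (every $b\in\mathbb{F}_q^k$ with $\sum_j b_j=0$ and $\sum_j b_jx_j=0$) is a linear combination of the rows of $A$. The system is temperate if there exist constants $\beta,\gamma>0$ with $\gamma<q$ such that for every $n$, every $S\subseteq\mathbb{F}_q^n$ with $|S|\ge\beta\gamma^n$ contains a generic solution $(x_1,\dots,x_k)\in S^k$. Two indices $j,j'\in[k]$ are equivalent if the $j$-th and $j'$-th columns of $A$ are nonzero scalar multiples of one another; the equivalence classes are the column equivalence classes. A class sums to zero if the columns indexed by it add up to the zero vector. Type (RC): balanced with at most one column equivalence class of size $1$. Non-degenerate: rows of $A$ linearly independent and no zero column. Two systems are equivalent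 if each equation of one is a linear combination of the equations of the other. A system is reducible if it is equivalent to a system whose variables can be partitioned into two or more classes such that every equation only uses (has nonzero coefficients on) variables from one class; otherwise irreducible. *)

theory Defs
  imports Complex_Main
begin

text \<open>A linear system over a finite field 'a (q = CARD('a)) with m equations in k
variables is given by a coefficient function A :: nat => nat => 'a, where A i j
(i < m, j < k) is the coefficient of x_j in equation i; values outside the ranges
are irrelevant. Vectors of F_q^n are functions nat => 'a vanishing from n on.\<close>

definition vecs :: "nat \<Rightarrow> (nat \<Rightarrow> 'a::zero) set" where
  "vecs n = {v. \<forall>t\<ge>n. v t = 0}"

definition in_rowspan :: "(nat \<Rightarrow> nat \<Rightarrow> 'a::field) \<Rightarrow> nat \<Rightarrow> nat \<Rightarrow> (nat \<Rightarrow> 'a) \<Rightarrow> bool" where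
  "in_rowspan A m k b \<longleftrightarrow> (\<exists>c. \<forall>j<k. b j = (\<Sum>i<m. c i * A i j))"

definition is_solution :: "(nat \<Rightarrow> nat \<Rightarrow> 'a::field) \<Rightarrow> nat \<Rightarrow> nat \<Rightarrow> (nat \<Rightarrow> nat \<Rightarrow> 'a) \<Rightarrow> bool" where
  "is_solution A m k x \<longleftrightarrow> (\<forall>i<m. \<forall>t. (\<Sum>j<k. A i j * x j t) = 0)"

definition is_generic :: "(nat \<Rightarrow> nat \<Rightarrow> 'a::field) \<Rightarrow> nat \<Rightarrow> nat \<Rightarrow> (nat \<Rightarrow> nat \<Rightarrow> 'a) \<Rightarrow> bool" where
  "is_generic A m k x \<longleftrightarrow>
     (\<forall>b::nat \<Rightarrow> 'a. (\<Sum>j<k. b j) = 0 \<and> (\<forall>t. (\<Sum>j<k. b j * x j t) = 0)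
        \<longrightarrow> in_rowspan A m k b)"

definition temperate :: "(nat \<Rightarrow> nat \<Rightarrow> 'a::{field,finite}) \<Rightarrow> nat \<Rightarrow> nat \<Rightarrow> bool" where
  "temperate A m k \<longleftrightarrow>
     (\<exists>\<beta> \<gamma>::real. \<beta> > 0 \<and> \<gamma> > 0 \<and> \<gamma> < real (card (UNIV :: 'a set)) \<and>
        (\<forall>n. \<forall>S. S \<subseteq> (vecs n :: (nat \<Rightarrow> 'a) set) \<and> real (card S) \<ge> \<beta> * \<gamma> ^ n \<longrightarrow>
           (\<exists>x. (\<forall>j<k. x j \<in> S) \<and> is_solution A m k x \<and> is_generic A m k x)))"

definition balanced_sys :: "(nat \<Rightarrow> nat \<Rightarrow> 'a::field) \<Rightarrow> nat \<Rightarrow> nat \<Rightarrow> bool" where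
  "balanced_sys A m k \<longleftrightarrow> (\<forall>i<m. (\<Sum>j<k. A i j) = 0)"

definition col_equiv :: "(nat \<Rightarrow> nat \<Rightarrow> 'a::field) \<Rightarrow> nat \<Rightarrow> nat \<Rightarrow> nat \<Rightarrow> bool" where
  "col_equiv A m j j' \<longleftrightarrow> (\<exists>c. c \<noteq> 0 \<and> (\<forall>i<m. A i j = c * A i j'))"

definition col_classes :: "(nat \<Rightarrow> nat \<Rightarrow> 'a::field) \<Rightarrow> nat \<Rightarrow> nat \<Rightarrow> nat set set" where
  "col_classes A m k = {{j'. j' < k \<and> col_equiv A m j j'} | j. j < k}"

definition class_sums_zero :: "(nat \<Rightarrow> nat \<Rightarrow> 'a::field) \<Rightarrow> nat \<Rightarrow> nat set \<Rightarrow> bool" where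
  "class_sums_zero A m C \<longleftrightarrow> (\<forall>i<m. (\<Sum>j\<in>C. A i j) = 0)"

definition type_RC :: "(nat \<Rightarrow> nat \<Rightarrow> 'a::field) \<Rightarrow> nat \<Rightarrow> nat \<Rightarrow> bool" where
  "type_RC A m k \<longleftrightarrow> balanced_sys A m k \<and> card {C \<in> col_classes A m k. card C = 1} \<le> 1"

definition non_degenerate :: "(nat \<Rightarrow> nat \<Rightarrow> 'a::field) \<Rightarrow> nat \<Rightarrow> nat \<Rightarrow> bool" where
  "non_degenerate A m k \<longleftrightarrow>
     (\<forall>c. (\<forall>j<k. (\<Sum>i<m. c i * A i j) = 0) \<longrightarrow> (\<forall>i<m. c i = 0)) \<and>
     (\<forall>j<k. \<exists>i<m. A i j \<noteq> 0)"

definition equiv_sys :: "(nat \<Rightarrow> nat \<Rightarrow> 'a::field) \<Rightarrow> nat \<Rightarrow> (nat \<Rightarrow> nat \<Rightarrow> 'a) \<Rightarrow> nat \<Rightarrow> nat \<Rightarrow> bool" where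
  "equiv_sys A m B m' k \<longleftrightarrow>
     (\<forall>i<m'. in_rowspan A m k (B i)) \<and> (\<forall>i<m. in_rowspan B m' k (A i))"

text \<open>Reducible: equivalent to a system whose variables can be partitioned (via a
labelling p) into at least two nonempty classes, each equation only using
variables of one class.\<close>
definition reducible :: "(nat \<Rightarrow> nat \<Rightarrow> 'a::field) \<Rightarrow> nat \<Rightarrow> nat \<Rightarrow> bool" where
  "reducible A m k \<longleftrightarrow>
     (\<exists>B m' (p::nat \<Rightarrow> nat). equiv_sys A m B m' k \<and>
        card (p ` {..<k}) \<ge> 2 \<and>
        (\<forall>i<m'. \<forall>j<k. \<forall>j'<k. B i j \<noteq> 0 \<and> B i j' \<noteq> 0 \<longrightarrow> p j = p j'))"

definition irreducible_sys :: "(nat \<Rightarrow> nat \<Rightarrow> 'a::field) \<Rightarrow> nat \<Rightarrow> nat \<Rightarrow> bool" where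
  "irreducible_sys A m k \<longleftrightarrow> \<not> reducible A m k"

end

theory Submission
  imports Defs "HOL-Library.FuncSet"
begin

text \<open>Every class \<open>C\<close> contributes one vector \<open>y\<^sub>C = (\<Sum>j\<in>C. \<kappa> j x\<^sub>j)\<close>, and the system only constrains the
  \<open>y\<^sub>C\<close>. Hence it suffices to find generic \<open>y\<^sub>C\<close> each of which is represented within \<open>S\<close> in so many ways
  that the representations can be chosen in general position one class after another.

  The slice rank method is needed only for \<open>\<alpha> x\<^sub>1 + \<beta> x\<^sub>2 = y\<close> with \<open>\<alpha> + \<beta> = 1\<close>: if every \<open>y \<in> S\<close> had few such
  representations, an independent set in the digraph of blocking points would have only trivial
  solutions. Nesting this statement shows that, outside an exponentially small set, every \<open>y \<in> S\<close> is
  abundantly represented by any affine combination.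

  If no class sums to zero and there are \<open>m + 1\<close> classes, the \<open>y\<^sub>C\<close> are forced to be fixed nonzero multiples
  of one vector \<open>y\<close>, and any abundantly represented \<open>y \<in> S\<close> works. If every class sums to zero, the
  \<open>y\<^sub>C\<close> are differences of points of \<open>S\<close>, and pigeonhole yields a generic solution consisting of
  popular differences.\<close>

section \<open>The slice rank bound\<close>

text \<open>The obstacle is genericity: slice rank yields only some nontrivial solution, while every
  relation outside the row span has to be excluded. Such relations are blocked through finite sets
  whose size depends on q, k and the number of classes but never on n, so they enlarge the constant
  factors and leave the base below q unchanged. An affine combination is reduced to two terms by
  replacing a group of coefficients by its sum, which must be nonzero. This gets stuck only when any
  two coefficients cancel; then the characteristic is 2, all coefficients are equal, and three of
  them are merged at once. Their equation x_i + x_j = y + x_k needs only pigeonhole, with base sqrt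
  q. A class with sum zero is not an affine combination. Splitting off one index with coefficient 1
  leaves the coefficients \<open>- \<kappa> j\<close>, whose sum is 1, so y_C = a - a' with a'
  abundantly represented by the other indices. Hence the pigeonhole for differences has to run
  inside the set of points already known to be abundantly represented.\<close>

lemma finite_field_power_card:
  fixes x :: "'a::{field,finite}"
  assumes "x \<noteq> 0"
  shows "x ^ (card (UNIV :: 'a set) - 1) = 1"
proof -
  let ?U = "UNIV - {0::'a}"
  have "(\<Prod>a\<in>?U. x * a) = (\<Prod>a\<in>?U. a)"
    by (rule prod.reindex_bij_witness[of _ "\<lambda>a. a / x" "\<lambda>a. x * a"]) (use assms in auto)
  then have "x ^ card ?U * (\<Prod>a\<in>?U. a) = (\<Prod>a\<in>?U. a)"
    by (simp add: prod.distrib)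
  moreover have "(\<Prod>a\<in>?U. a) \<noteq> 0"
    by simp
  ultimately show ?thesis
    by (simp add: card_Diff_singleton)
qed

text \<open>Over a finite field counting replaces rank: there are more weightings of
  \<open>X\<close> than value vectors on \<open>I\<close>, so two weightings collide and their
  difference is \<open>w\<close>. It is extended by zero so that it can be added to weightings of a
  larger set.\<close>

lemma homogeneous_solution:
  fixes p :: "'i \<Rightarrow> 'x \<Rightarrow> 'a::{field,finite}"
  assumes "finite I" "finite X" "card I < card X"
  obtains w where "\<And>x. x \<notin> X \<Longrightarrow> w x = 0" "\<exists>x\<in>X. w x \<noteq> 0"
    "\<And>i. i \<in> I \<Longrightarrow> (\<Sum>x\<in>X. w x * p i x) = 0"
proof -
  let ?P = "PiE X (\<lambda>_. UNIV :: 'a set)"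
  let ?f = "\<lambda>w. restrict (\<lambda>i. \<Sum>x\<in>X. w x * p i x) I"
  have q: "1 < card (UNIV :: 'a set)"
    using card_mono[of UNIV "{0, 1::'a}"] by simp
  have "card (?f ` ?P) \<le> card (PiE I (\<lambda>_. UNIV :: 'a set))"
    by (rule card_mono) (auto intro!: finite_PiE assms)
  also have "\<dots> = card (UNIV :: 'a set) ^ card I"
    using assms by (simp add: card_PiE)
  also have "\<dots> < card (UNIV :: 'a set) ^ card X"
    using q assms by (intro power_strict_increasing)
  also have "\<dots> = card ?P"
    using assms by (simp add: card_PiE)
  finally have "\<not> inj_on ?f ?P"
    by (rule pigeonhole)
  then obtain w1 w2 where w: "w1 \<in> ?P" "w2 \<in> ?P" "w1 \<noteq> w2" "?f w1 = ?f w2"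
    by (auto simp: inj_on_def)
  define w where "w = (\<lambda>x. if x \<in> X then w1 x - w2 x else 0)"
  show thesis
  proof
    show "w x = 0" if "x \<notin> X" for x
      using that by (simp add: w_def)
    show "\<exists>x\<in>X. w x \<noteq> 0"
    proof (rule ccontr)
      assume "\<not> ?thesis"
      then have "w1 = w2"
        using w(1,2) by (intro PiE_ext[of w1 X "\<lambda>_. UNIV" w2]) (auto simp: w_def)
      then show False
        using w(3) by simp
    qed
    show "(\<Sum>x\<in>X. w x * p i x) = 0" if "i \<in> I" for i
    proof -
      have "(\<Sum>x\<in>X. w x * p i x) = (\<Sum>x\<in>X. w1 x * p i x) - (\<Sum>x\<in>X. w2 x * p i x)"
        by (simp add: w_def left_diff_distrib sum_subtractf)
      then show ?thesis
        using fun_cong[OF w(4), of i] that by simp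
    qed
  qed
qed

text \<open>Slice rank of the identity tensor, by contraction. A weighting \<open>v\<close> that
  annihilates every \<open>p a\<close> removes the first sum and leaves the diagonal matrix with
  entries \<open>v y\<close>, written as \<open>2 * card M\<close> products. Such a \<open>v\<close>
  can be nonzero at \<open>card T - card M\<close> points or more, and the rank of the matrix bounds
  that number by \<open>2 * card M\<close>.\<close>

lemma diagonal_slice_rank:
  fixes p :: "'i \<Rightarrow> 'x \<Rightarrow> 'a::{field,finite}"
  assumes T: "finite T" and M: "finite M"
    and dec: "\<And>x y z. x \<in> T \<Longrightarrow> y \<in> T \<Longrightarrow> z \<in> T \<Longrightarrow>
      (if x = y \<and> y = z then 1 else 0) =
        (\<Sum>a\<in>M. p a x * F a y z) + (\<Sum>a\<in>M. p a y * G a x z) + (\<Sum>a\<in>M. p a z * H a x y)"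
  shows "card T \<le> 3 * card M"
proof -
  define V where "V = {v. (\<forall>x. x \<notin> T \<longrightarrow> v x = 0) \<and> (\<forall>a\<in>M. (\<Sum>x\<in>T. v x * p a x) = 0)}"
  define supp where "supp = (\<lambda>v::'x \<Rightarrow> 'a. {x\<in>T. v x \<noteq> 0})"
  have "(\<lambda>_. 0) \<in> V"
    by (simp add: V_def)
  moreover have "\<forall>v. v \<in> V \<longrightarrow> card (supp v) < Suc (card T)"
    using T by (auto simp: supp_def less_Suc_eq_le intro: card_mono)
  \<comment> \<open>Support of maximal size: with more than \<open>card M\<close> points outside it,
    some nonzero \<open>w\<close> in \<open>V\<close> would live there, and adding it to
    \<open>v\<close> would enlarge the support.\<close>
  ultimately obtain v where v: "v \<in> V" "\<And>v'. v' \<in> V \<Longrightarrow> card (supp v') \<le> card (supp v)"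
    using ex_has_greatest_nat[of "\<lambda>v. v \<in> V" "\<lambda>_. 0" "\<lambda>v. card (supp v)"] by blast
  define N where "N = supp v"
  have N: "N \<subseteq> T" "finite N"
    using T by (auto simp: N_def supp_def)
  have "card T \<le> card N + card M"
  proof (rule ccontr)
    assume "\<not> ?thesis"
    then have "card M < card (T - N)"
      using N by (simp add: card_Diff_subset)
    then obtain w where w: "\<And>x. x \<notin> T - N \<Longrightarrow> w x = 0" "\<exists>x\<in>T - N. w x \<noteq> 0"
        "\<And>a. a \<in> M \<Longrightarrow> (\<Sum>x\<in>T - N. w x * p a x) = 0"
      using homogeneous_solution[of M "T - N" p] T M by auto
    have "(\<Sum>x\<in>T. w x * p a x) = 0" if "a \<in> M" for a
      using w(3)[OF that] sum.mono_neutral_right[of T "T - N" "\<lambda>x. w x * p a x"] w(1) T by auto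
    then have "(\<lambda>x. v x + w x) \<in> V"
      using v(1) w(1) by (auto simp: V_def distrib_right sum.distrib)
    then have "card (supp (\<lambda>x. v x + w x)) \<le> card N"
      using v(2) by (simp add: N_def)
    moreover have "N \<subset> supp (\<lambda>x. v x + w x)"
    proof -
      obtain x where x: "x \<in> T - N" "w x \<noteq> 0"
        using w(2) by blast
      have "N \<subseteq> supp (\<lambda>x. v x + w x)"
        using w(1) by (auto simp: N_def supp_def)
      moreover have "x \<in> supp (\<lambda>x. v x + w x)" "x \<notin> N"
        using x by (auto simp: N_def supp_def)
      ultimately show ?thesis
        by blast
    qed
    ultimately show False
      using psubset_card_mono[of "supp (\<lambda>x. v x + w x)" N] T by (simp add: supp_def)
  qed
  moreover have "card N \<le> 2 * card M"
  proof (rule ccontr)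
    assume *: "\<not> ?thesis"
    define H' where "H' = (\<lambda>a y. \<Sum>x\<in>T. v x * H a x y)"
    define G' where "G' = (\<lambda>a z. \<Sum>x\<in>T. v x * G a x z)"
    \<comment> \<open>The factors depending on \<open>y\<close> alone in the contracted identity are
      the \<open>p a\<close> and the \<open>H' a\<close>. A nonzero weighting on the support that is
      orthogonal to all of them annihilates the products but not the diagonal.\<close>
    define pp where "pp = case_sum p H'"
    have "card (M <+> M) < card N"
      using * M by (simp add: card_Plus)
    then obtain w where w: "\<And>x. x \<notin> N \<Longrightarrow> w x = 0" "\<exists>x\<in>N. w x \<noteq> 0"
        "\<And>a. a \<in> M <+> M \<Longrightarrow> (\<Sum>x\<in>N. w x * pp a x) = 0"
      using homogeneous_solution[of "M <+> M" N pp] N M by auto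
    have wp: "(\<Sum>y\<in>N. w y * p a y) = 0" "(\<Sum>y\<in>N. w y * H' a y) = 0" if "a \<in> M" for a
      using w(3)[of "Inl a"] w(3)[of "Inr a"] that by (auto simp: pp_def)
    have diag: "(if y = z then v y else 0) = (\<Sum>a\<in>M. p a y * G' a z) + (\<Sum>a\<in>M. p a z * H' a y)"
      if "y \<in> T" "z \<in> T" for y z
    proof -
      have "(if y = z then v y else 0) = (\<Sum>x\<in>T. v x * (if x = y \<and> y = z then 1 else 0))"
        using that T by (simp add: if_distrib[of "\<lambda>c. _ * c"] sum.delta cong: if_cong)
      also have "\<dots> = (\<Sum>x\<in>T. v x * ((\<Sum>a\<in>M. p a x * F a y z) + (\<Sum>a\<in>M. p a y * G a x z) + (\<Sum>a\<in>M. p a z * H a x y)))"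
        using that by (intro sum.cong refl) (simp only: dec)
      also have "\<dots> = (\<Sum>x\<in>T. \<Sum>a\<in>M. v x * p a x * F a y z) + (\<Sum>x\<in>T. \<Sum>a\<in>M. p a y * (v x * G a x z)) + (\<Sum>x\<in>T. \<Sum>a\<in>M. p a z * (v x * H a x y))"
        by (simp add: distrib_left sum.distrib sum_distrib_left mult_ac)
      also have "(\<Sum>x\<in>T. \<Sum>a\<in>M. v x * p a x * F a y z) = (\<Sum>a\<in>M. (\<Sum>x\<in>T. v x * p a x) * F a y z)"
        by (subst sum.swap) (simp add: sum_distrib_right)
      also have "\<dots> = 0"
        using v(1) by (simp add: V_def)
      also have "(\<Sum>x\<in>T. \<Sum>a\<in>M. p a y * (v x * G a x z)) = (\<Sum>a\<in>M. p a y * G' a z)"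
        by (subst sum.swap) (simp add: sum_distrib_left G'_def)
      also have "(\<Sum>x\<in>T. \<Sum>a\<in>M. p a z * (v x * H a x y)) = (\<Sum>a\<in>M. p a z * H' a y)"
        by (subst sum.swap) (simp add: sum_distrib_left H'_def)
      finally show ?thesis
        by simp
    qed
    obtain z where z: "z \<in> N" "w z \<noteq> 0"
      using w(2) by blast
    have "w z * v z = (\<Sum>y\<in>N. w y * (if y = z then v y else 0))"
      using z N by (simp add: if_distrib[of "\<lambda>c. _ * c"] sum.delta cong: if_cong)
    also have "\<dots> = (\<Sum>y\<in>N. w y * ((\<Sum>a\<in>M. p a y * G' a z) + (\<Sum>a\<in>M. p a z * H' a y)))"
    proof (intro sum.cong refl)
      fix y assume "y \<in> N"
      then have "y \<in> T" "z \<in> T" using N z by auto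
      then show "w y * (if y = z then v y else 0) = w y * ((\<Sum>a\<in>M. p a y * G' a z) + (\<Sum>a\<in>M. p a z * H' a y))"
        by (simp only: diag)
    qed
    also have "\<dots> = (\<Sum>y\<in>N. \<Sum>a\<in>M. w y * p a y * G' a z) + (\<Sum>y\<in>N. \<Sum>a\<in>M. p a z * (w y * H' a y))"
      by (simp add: distrib_left sum.distrib sum_distrib_left mult_ac)
    also have "\<dots> = (\<Sum>a\<in>M. (\<Sum>y\<in>N. w y * p a y) * G' a z) + (\<Sum>a\<in>M. p a z * (\<Sum>y\<in>N. w y * H' a y))"
      by (subst (1 2) sum.swap) (simp add: sum_distrib_right sum_distrib_left)
    also have "\<dots> = 0"
      by (simp add: wp)
    finally show False
      using z by (simp add: N_def supp_def)
  qed
  ultimately show ?thesis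
    by simp
qed

text \<open>For d = q - 1 the left-hand side is the indicator of \<alpha> x + \<beta> y = z in one
  coordinate. \<open>None\<close> indexes the constant 1 and \<open>Some (a, b)\<close> the
  trinomial term with exponents a, b and d - a - b.\<close>

lemma one_coordinate_expansion:
  fixes \<alpha> \<beta> :: "'a::field"
  obtains J :: "(nat \<times> nat) option set" and c and f g h :: "(nat \<times> nat) option \<Rightarrow> nat"
  where "finite J" "\<And>j. j \<in> J \<Longrightarrow> f j + g j + h j \<le> d"
    "\<And>x y z. 1 - (\<alpha> * x + \<beta> * y - z) ^ d = (\<Sum>j\<in>J. c j * (x ^ f j * y ^ g j * z ^ h j))"
proof -
  define I where "I = (SIGMA a:{..d}. {..d - a})"
  define J where "J = insert None (Some ` I)"
  define f :: "(nat \<times> nat) option \<Rightarrow> nat" where "f = (\<lambda>j. case j of None \<Rightarrow> 0 | Some (a, b) \<Rightarrow> (a::nat))"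
  define g :: "(nat \<times> nat) option \<Rightarrow> nat" where "g = (\<lambda>j. case j of None \<Rightarrow> 0 | Some (a, b) \<Rightarrow> (b::nat))"
  define h :: "(nat \<times> nat) option \<Rightarrow> nat" where "h = (\<lambda>j. case j of None \<Rightarrow> 0 | Some (a, b) \<Rightarrow> d - a - b)"
  define c :: "(nat \<times> nat) option \<Rightarrow> 'a" where "c = (\<lambda>j. case j of None \<Rightarrow> 1 | Some (a, b) \<Rightarrow>
     - (of_nat (d choose a) * of_nat ((d - a) choose b) * \<alpha> ^ a * \<beta> ^ b * (- 1) ^ (d - a - b)))"
  have I: "finite I"
    by (simp add: I_def)
  show thesis
  proof
    show "finite J"
      using I by (simp add: J_def)
    show "f j + g j + h j \<le> d" if "j \<in> J" for j
      using that by (auto simp: J_def I_def f_def g_def h_def)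
    fix x y z :: 'a
    have "(\<alpha> * x + \<beta> * y - z) ^ d = (\<alpha> * x + (\<beta> * y + - z)) ^ d"
      by (simp add: algebra_simps)
    also have "\<dots> = (\<Sum>a\<le>d. of_nat (d choose a) * (\<alpha> * x) ^ a * (\<beta> * y + - z) ^ (d - a))"
      by (rule binomial_ring)
    also have "\<dots> = (\<Sum>a\<le>d. \<Sum>b\<le>d - a. - c (Some (a, b)) * (x ^ a * y ^ b * z ^ (d - a - b)))"
    proof (intro sum.cong refl)
      fix a
      have mz: "(- z) ^ e = (- 1) ^ e * z ^ e" for e
        by (metis mult_minus1 power_mult_distrib)
      show "of_nat (d choose a) * (\<alpha> * x) ^ a * (\<beta> * y + - z) ^ (d - a) =
        (\<Sum>b\<le>d - a. - c (Some (a, b)) * (x ^ a * y ^ b * z ^ (d - a - b)))"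
        by (subst binomial_ring, subst sum_distrib_left)
          (intro sum.cong refl, simp add: c_def power_mult_distrib mz mult_ac)
    qed
    also have "\<dots> = (\<Sum>(a, b)\<in>I. - c (Some (a, b)) * (x ^ a * y ^ b * z ^ (d - a - b)))"
      unfolding I_def by (rule sum.Sigma) auto
    finally have *: "(\<alpha> * x + \<beta> * y - z) ^ d = (\<Sum>i\<in>I. - c (Some i) * (x ^ f (Some i) * y ^ g (Some i) * z ^ h (Some i)))"
      by (simp add: f_def g_def h_def case_prod_unfold)
    have "(\<Sum>j\<in>J. c j * (x ^ f j * y ^ g j * z ^ h j)) =
      1 + (\<Sum>i\<in>I. c (Some i) * (x ^ f (Some i) * y ^ g (Some i) * z ^ h (Some i)))"
      unfolding J_def using I by (subst sum.insert) (auto simp: sum.reindex f_def g_def h_def c_def)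
    then show "1 - (\<alpha> * x + \<beta> * y - z) ^ d = (\<Sum>j\<in>J. c j * (x ^ f j * y ^ g j * z ^ h j))"
      by (simp add: * sum_negf)
  qed
qed

text \<open>Chernoff bound: for \<theta> in (0, 1) each counted exponent vector contributes at least
  \<open>\<theta> ^ (d * n)\<close> to \<open>(\<Sum>v\<le>d. \<theta> ^ (3 * v)) ^ n\<close>. The
  mean exponent d / 2 lies above the cutoff d / 3, so a \<theta> slightly below 1 gives an
  exponential gain. The factor 3 clears the denominator of the cutoff.\<close>

lemma low_degree_count:
  assumes "d \<ge> 1"
  obtains \<gamma> :: real where "0 < \<gamma>" "\<gamma> < real (Suc d)"
    "\<And>n. real (card {a \<in> PiE {..<n} (\<lambda>_. {..d}). 3 * sum a {..<n} \<le> d * n}) \<le> \<gamma> ^ n"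
proof -
  \<comment> \<open>For \<theta> > 0, \<open>g \<theta> < 0\<close> says that the base
    \<open>\<gamma>\<close> defined below is less than \<open>Suc d\<close>. Since
    \<open>g 1 = 0\<close> and the derivative at 1 is positive, points just left of 1
    qualify.\<close>
  define g where "g = (\<lambda>\<theta>::real. (\<Sum>v\<le>d. \<theta> ^ (3 * v)) - real (Suc d) * \<theta> ^ d)"
  have deriv: "(g has_real_derivative (\<Sum>v\<le>d. real (3 * v) * 1 ^ (3 * v - 1)) - real (Suc d) * (real d * 1 ^ (d - 1))) (at 1)"
    unfolding g_def by (auto intro!: derivative_eq_intros)
  have "(\<Sum>v\<le>d. real (3 * v) * 1 ^ (3 * v - 1)) = 3 * (\<Sum>v\<le>d. real v)"
    by (simp add: sum_distrib_left)
  moreover have "2 * (\<Sum>v\<le>d. real v) = real d * (real d + 1)"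
    by (induction d) (auto simp: algebra_simps)
  ultimately have "(\<Sum>v\<le>d. real (3 * v) * 1 ^ (3 * v - 1)) - real (Suc d) * (real d * 1 ^ (d - 1)) =
      real d * (real d + 1) / 2"
    by (simp add: algebra_simps)
  with deriv have "(g has_real_derivative (real d * (real d + 1) / 2)) (at 1)"
    by (simp only:)
  moreover have "real d * (real d + 1) / 2 > 0"
    using assms by simp
  ultimately obtain \<epsilon> where \<epsilon>: "\<epsilon> > 0" "\<And>h. h > 0 \<Longrightarrow> h < \<epsilon> \<Longrightarrow> g (1 - h) < g 1"
    using DERIV_pos_inc_left[of g _ 1] by blast
  define \<theta> where "\<theta> = 1 - min (\<epsilon> / 2) (1 / 2)"
  have \<theta>: "0 < \<theta>" "\<theta> < 1"
    using \<epsilon>(1) by (auto simp: \<theta>_def)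
  have "g \<theta> < g 1"
    unfolding \<theta>_def using \<epsilon>(1) by (intro \<epsilon>(2)) auto
  then have g: "(\<Sum>v\<le>d. \<theta> ^ (3 * v)) < real (Suc d) * \<theta> ^ d"
    by (simp add: g_def)
  define \<gamma> where "\<gamma> = (\<Sum>v\<le>d. \<theta> ^ (3 * v)) / \<theta> ^ d"
  show thesis
  proof
    show "0 < \<gamma>"
      unfolding \<gamma>_def using \<theta> by (intro divide_pos_pos sum_pos) auto
    show "\<gamma> < real (Suc d)"
      unfolding \<gamma>_def using \<theta> g by (simp add: divide_less_eq)
    fix n :: nat
    let ?P = "PiE {..<n} (\<lambda>_. {..d})"
    let ?M = "{a \<in> ?P. 3 * sum a {..<n} \<le> d * n}"
    have fin: "finite ?P"
      by (intro finite_PiE) auto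
    have "real (card ?M) * \<theta> ^ (d * n) = (\<Sum>a\<in>?M. \<theta> ^ (d * n))"
      by simp
    also have "\<dots> \<le> (\<Sum>a\<in>?M. \<theta> ^ (3 * sum a {..<n}))"
      using \<theta> by (intro sum_mono power_decreasing) auto
    also have "\<dots> \<le> (\<Sum>a\<in>?P. \<theta> ^ (3 * sum a {..<n}))"
      using \<theta> fin by (intro sum_mono2) auto
    also have "\<dots> = (\<Sum>a\<in>?P. \<Prod>i<n. \<theta> ^ (3 * a i))"
      by (simp add: power_sum sum_distrib_left)
    also have "\<dots> = (\<Prod>i<n. \<Sum>v\<le>d. \<theta> ^ (3 * v))"
      by (rule prod_sum_PiE[symmetric]) auto
    also have "\<dots> = (\<Sum>v\<le>d. \<theta> ^ (3 * v)) ^ n"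
      by simp
    finally show "real (card ?M) \<le> \<gamma> ^ n"
      using \<theta> by (simp add: \<gamma>_def power_divide power_mult pos_le_divide_eq)
  qed
qed

section \<open>Vectors over the finite field, and sets with only trivial solutions\<close>

lemma bij_betw_vecs:
  "bij_betw (\<lambda>v. restrict v {..<n}) (vecs n) (PiE {..<n} (\<lambda>_. UNIV))"
proof (rule bij_betw_byWitness[where f' = "\<lambda>w i. if i < n then w i else 0"])
  show "\<forall>v\<in>vecs n. (\<lambda>i. if i < n then restrict v {..<n} i else 0) = v"
    by (auto simp: vecs_def)
  show "\<forall>w\<in>PiE {..<n} (\<lambda>_. UNIV). restrict (\<lambda>i. if i < n then w i else 0) {..<n} = w"
    by (auto intro!: ext simp: PiE_def extensional_def)
  show "(\<lambda>v. restrict v {..<n}) ` vecs n \<subseteq> PiE {..<n} (\<lambda>_. UNIV)"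
    by (intro image_subsetI) (simp add: restrict_PiE_iff)
  show "(\<lambda>w i. if i < n then w i else 0) ` PiE {..<n} (\<lambda>_. UNIV) \<subseteq> vecs n"
    by (intro image_subsetI) (simp add: vecs_def)
qed

lemma finite_vecs: "finite (vecs n :: (nat \<Rightarrow> 'a::{field,finite}) set)"
  using bij_betw_finite[OF bij_betw_vecs[where 'a = 'a, of n]] by (simp add: finite_PiE)

lemma card_vecs: "card (vecs n :: (nat \<Rightarrow> 'a::{field,finite}) set) = card (UNIV :: 'a set) ^ n"
  using bij_betw_same_card[OF bij_betw_vecs[where 'a = 'a]] by (simp add: card_PiE)

lemma card_field_ge_2: "2 \<le> card (UNIV :: 'a::{field,finite} set)"
  using card_mono[of UNIV "{0, 1::'a}"] by simp

lemma zero_one_indicator: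
  fixes x :: "'a::{field,finite}"
  shows "1 - x ^ (card (UNIV :: 'a set) - 1) = (if x = 0 then 1 else 0)"
proof (cases "x = 0")
  case True
  have "card (UNIV :: 'a set) - 1 \<noteq> 0"
    using card_field_ge_2[where 'a = 'a] by linarith
  then show ?thesis
    using True by (simp only: power_0_left) simp
next
  case False
  then show ?thesis
    using finite_field_power_card[of x] by simp
qed

text \<open>The polynomial method of Croot-Lev-Pach and Ellenberg-Gijswijt. On \<open>T\<close> the
  indicator of \<alpha> x + \<beta> y = z is the identity tensor: the diagonal solves the equation
  because \<alpha> + \<beta> = 1, and no other triple does. Its monomials have total degree at most
  (q - 1) n, so in each of them one of the three variables has at most a third of that degree; the
  low-degree monomials are the factors \<open>p\<close>.\<close>

lemma no_nontrivial_solution_bound: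
  fixes \<alpha> \<beta> :: "'a::{field,finite}"
  assumes "\<alpha> + \<beta> = 1"
  shows "\<exists>\<gamma>::real. 0 < \<gamma> \<and> \<gamma> < real (card (UNIV :: 'a set)) \<and>
    (\<forall>n. \<forall>T\<subseteq>(vecs n :: (nat \<Rightarrow> 'a) set).
      (\<forall>x\<in>T. \<forall>y\<in>T. \<forall>z\<in>T. (\<lambda>t. \<alpha> * x t + \<beta> * y t) = z \<longrightarrow> x = y \<and> y = z) \<longrightarrow>
      real (card T) \<le> 3 * \<gamma> ^ n)"
proof -
  define d where "d = card (UNIV :: 'a set) - 1"
  have d: "d \<ge> 1" "Suc d = card (UNIV :: 'a set)"
    using card_field_ge_2[where 'a = 'a] by (auto simp: d_def)
  obtain J :: "(nat \<times> nat) option set" and f g h c where J: "finite J" "\<And>j. j \<in> J \<Longrightarrow> f j + g j + h j \<le> d"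
    and expand: "\<And>x y z. 1 - (\<alpha> * x + \<beta> * y - z) ^ d = (\<Sum>j\<in>J. c j * (x ^ f j * y ^ g j * z ^ h j))"
    by (rule one_coordinate_expansion[of d \<alpha> \<beta>]) (rule that)
  obtain \<gamma> :: real where \<gamma>: "0 < \<gamma>" "\<gamma> < real (Suc d)"
    "\<And>n. real (card {a \<in> PiE {..<n} (\<lambda>_. {..d}). 3 * sum a {..<n} \<le> d * n}) \<le> \<gamma> ^ n"
    by (rule low_degree_count[OF d(1)]) (rule that)
  show ?thesis
  proof (intro exI[of _ \<gamma>] conjI allI impI)
    show "0 < \<gamma>" "\<gamma> < real (card (UNIV :: 'a set))"
      using \<gamma> d by auto
    fix n and T :: "(nat \<Rightarrow> 'a) set"
    assume T: "T \<subseteq> vecs n"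
      and triv: "\<forall>x\<in>T. \<forall>y\<in>T. \<forall>z\<in>T. (\<lambda>t. \<alpha> * x t + \<beta> * y t) = z \<longrightarrow> x = y \<and> y = z"
    have vanish: "v i = 0" if "v \<in> T" "n \<le> i" for v i
      using T that by (force simp: vecs_def)
    define M where "M = {a \<in> PiE {..<n} (\<lambda>_. {..d}). 3 * sum a {..<n} \<le> d * n}"
    define mon where "mon = (\<lambda>(a::nat \<Rightarrow> nat) (x::nat \<Rightarrow> 'a). \<Prod>i<n. x i ^ a i)"
    define \<Phi> where "\<Phi> = PiE {..<n} (\<lambda>_. J)"
    define cc where "cc = (\<lambda>\<phi>. \<Prod>i<n. c (\<phi> i))"
    define r where "r = (\<lambda>(f::(nat \<times> nat) option \<Rightarrow> nat) \<phi>. restrict (\<lambda>i. f (\<phi> i)) {..<n})"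
    \<comment> \<open>A term \<open>\<phi>\<close> picks one monomial for each coordinate. It is
      assigned to the first of x, y, z whose degree in it is at most d n / 3; terms left over for
      \<open>\<Phi>3\<close> have low degree in z because the three degrees add up to at most d
      n.\<close>
    define \<Phi>1 where "\<Phi>1 = {\<phi> \<in> \<Phi>. 3 * sum (r f \<phi>) {..<n} \<le> d * n}"
    define \<Phi>2 where "\<Phi>2 = {\<phi> \<in> \<Phi> - \<Phi>1. 3 * sum (r g \<phi>) {..<n} \<le> d * n}"
    define \<Phi>3 where "\<Phi>3 = \<Phi> - \<Phi>1 - \<Phi>2"
    have "finite (PiE {..<n} (\<lambda>_. {..d}))"
      by (simp add: finite_PiE)
    then have fin: "finite M" "finite \<Phi>"
      unfolding M_def \<Phi>_def using J(1) by (simp_all add: finite_PiE)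
    have fins: "finite \<Phi>1" "finite \<Phi>2" "finite \<Phi>3"
      using fin by (auto simp: \<Phi>1_def \<Phi>2_def \<Phi>3_def)
    have rM: "r f' \<phi> \<in> M" if "\<phi> \<in> \<Phi>" "3 * sum (r f' \<phi>) {..<n} \<le> d * n" "\<And>j. j \<in> J \<Longrightarrow> f' j \<le> d" for f' \<phi>
      using that by (auto simp: M_def r_def \<Phi>_def)
    have deg: "f j \<le> d" "g j \<le> d" "h j \<le> d" if "j \<in> J" for j
      using J(2)[OF that] by auto
    have r1: "r f ` \<Phi>1 \<subseteq> M" and r2: "r g ` \<Phi>2 \<subseteq> M"
      using rM deg by (auto simp: \<Phi>1_def \<Phi>2_def)
    have r3: "r h ` \<Phi>3 \<subseteq> M"
    proof (intro image_subsetI rM deg)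
      fix \<phi> assume \<phi>: "\<phi> \<in> \<Phi>3"
      then show "\<phi> \<in> \<Phi>"
        by (simp add: \<Phi>3_def)
      then have "(\<Sum>i<n. f (\<phi> i) + g (\<phi> i) + h (\<phi> i)) \<le> (\<Sum>i<n. d)"
        by (intro sum_mono J(2)) (auto simp: \<Phi>_def)
      then have "sum (r f \<phi>) {..<n} + sum (r g \<phi>) {..<n} + sum (r h \<phi>) {..<n} \<le> d * n"
        by (simp add: r_def sum.distrib mult.commute)
      then show "3 * sum (r h \<phi>) {..<n} \<le> d * n"
        using \<phi> by (auto simp: \<Phi>1_def \<Phi>2_def \<Phi>3_def)
    qed
    \<comment> \<open>Terms with the same low-degree monomial form one slice, so the number of
      slices is \<open>card M\<close> and not the number of terms.\<close>
    have group: "(\<Sum>\<phi>\<in>\<Psi>. mon (r f' \<phi>) x * K \<phi>) = (\<Sum>a\<in>M. mon a x * (\<Sum>\<phi>\<in>{\<phi>\<in>\<Psi>. r f' \<phi> = a}. K \<phi>))"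
      if "finite \<Psi>" "r f' ` \<Psi> \<subseteq> M" for \<Psi> f' x K
    proof -
      have "(\<Sum>a\<in>M. mon a x * (\<Sum>\<phi>\<in>{\<phi>\<in>\<Psi>. r f' \<phi> = a}. K \<phi>)) =
          (\<Sum>a\<in>M. \<Sum>\<phi>\<in>{\<phi>\<in>\<Psi>. r f' \<phi> = a}. mon (r f' \<phi>) x * K \<phi>)"
        by (simp add: sum_distrib_left)
      also have "\<dots> = (\<Sum>\<phi>\<in>\<Psi>. mon (r f' \<phi>) x * K \<phi>)"
        using that fin by (intro sum.group)
      finally show ?thesis
        by simp
    qed
    define F where "F = (\<lambda>a y z. \<Sum>\<phi>\<in>{\<phi>\<in>\<Phi>1. r f \<phi> = a}. cc \<phi> * mon (r g \<phi>) y * mon (r h \<phi>) z)"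
    define G where "G = (\<lambda>a x z. \<Sum>\<phi>\<in>{\<phi>\<in>\<Phi>2. r g \<phi> = a}. cc \<phi> * mon (r f \<phi>) x * mon (r h \<phi>) z)"
    define H where "H = (\<lambda>a x y. \<Sum>\<phi>\<in>{\<phi>\<in>\<Phi>3. r h \<phi> = a}. cc \<phi> * mon (r f \<phi>) x * mon (r g \<phi>) y)"
    have "card T \<le> 3 * card M"
    proof (rule diagonal_slice_rank[where p = mon and F = F and G = G and H = H])
      show "finite T"
        using T finite_vecs finite_subset by blast
      fix x y z assume xyz: "x \<in> T" "y \<in> T" "z \<in> T"
      let ?e = "\<lambda>\<phi>. cc \<phi> * mon (r f \<phi>) x * mon (r g \<phi>) y * mon (r h \<phi>) z"
      have "(x = y \<and> y = z) \<longleftrightarrow> (\<forall>i<n. \<alpha> * x i + \<beta> * y i - z i = 0)"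
      proof
        assume "x = y \<and> y = z"
        then show "\<forall>i<n. \<alpha> * x i + \<beta> * y i - z i = 0"
          using assms by (simp flip: distrib_right)
      next
        assume *: "\<forall>i<n. \<alpha> * x i + \<beta> * y i - z i = 0"
        have "\<alpha> * x i + \<beta> * y i = z i" for i
          using * xyz by (cases "i < n") (auto simp: vanish)
        then have "(\<lambda>t. \<alpha> * x t + \<beta> * y t) = z"
          by (rule ext)
        then show "x = y \<and> y = z"
          using triv[rule_format, OF xyz] by simp
      qed
      then have "(if x = y \<and> y = z then 1 else 0) = (\<Prod>i<n. 1 - (\<alpha> * x i + \<beta> * y i - z i) ^ d)"
        unfolding d_def zero_one_indicator by auto
      also have "\<dots> = (\<Sum>\<phi>\<in>\<Phi>. \<Prod>i<n. c (\<phi> i) * (x i ^ f (\<phi> i) * y i ^ g (\<phi> i) * z i ^ h (\<phi> i)))"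
        unfolding expand \<Phi>_def using J(1) by (intro prod_sum_PiE) auto
      also have "\<dots> = (\<Sum>\<phi>\<in>\<Phi>. ?e \<phi>)"
        by (intro sum.cong refl) (simp add: cc_def mon_def r_def prod.distrib mult_ac)
      also have "\<Phi> = \<Phi>1 \<union> (\<Phi>2 \<union> \<Phi>3)"
        by (auto simp: \<Phi>1_def \<Phi>2_def \<Phi>3_def)
      also have "sum ?e \<dots> = sum ?e \<Phi>1 + (sum ?e \<Phi>2 + sum ?e \<Phi>3)"
        using fins by (subst sum.union_disjoint, simp, simp, force simp: \<Phi>1_def \<Phi>2_def \<Phi>3_def)
          (subst sum.union_disjoint, auto simp: \<Phi>1_def \<Phi>2_def \<Phi>3_def)
      also have "sum ?e \<Phi>1 = (\<Sum>a\<in>M. mon a x * F a y z)"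
        unfolding F_def by (subst group[OF fins(1) r1, symmetric]) (simp add: mult_ac)
      also have "sum ?e \<Phi>2 = (\<Sum>a\<in>M. mon a y * G a x z)"
        unfolding G_def by (subst group[OF fins(2) r2, symmetric]) (simp add: mult_ac)
      also have "sum ?e \<Phi>3 = (\<Sum>a\<in>M. mon a z * H a x y)"
        unfolding H_def by (subst group[OF fins(3) r3, symmetric]) (simp add: mult_ac)
      finally show "(if x = y \<and> y = z then 1 else 0) =
          (\<Sum>a\<in>M. mon a x * F a y z) + (\<Sum>a\<in>M. mon a y * G a x z) + (\<Sum>a\<in>M. mon a z * H a x y)"
        by (simp add: add.assoc)
    qed (use fin in auto)
    then have "real (card T) \<le> 3 * real (card M)"
      by linarith
    also have "\<dots> \<le> 3 * \<gamma> ^ n"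
      using \<gamma>(3)[of n] by (simp add: M_def)
    finally show "real (card T) \<le> 3 * \<gamma> ^ n" .
  qed
qed

text \<open>Greedy choice: in-degrees average at most \<open>h\<close>, so some vertex has at most
  \<open>2 * h\<close> neighbours in both directions together. It is kept, its neighbours are
  discarded, and the rest is treated by induction. Loops are harmless, hence the conclusion
  \<open>x = y\<close>.\<close>

lemma independent_set_bounded_outdegree:
  fixes H :: "'x \<Rightarrow> 'x set"
  assumes "finite S" "\<And>y. y \<in> S \<Longrightarrow> finite (H y) \<and> card (H y) \<le> h"
  obtains T where "T \<subseteq> S" "card S \<le> (2 * h + 1) * card T"
    "\<And>x y. x \<in> T \<Longrightarrow> y \<in> T \<Longrightarrow> x \<in> H y \<Longrightarrow> x = y"
proof -
  have "\<exists>T\<subseteq>S. card S \<le> (2 * h + 1) * card T \<and> (\<forall>x\<in>T. \<forall>y\<in>T. x \<in> H y \<longrightarrow> x = y)"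
    using assms
  proof (induction "card S" arbitrary: S rule: less_induct)
    case less
    show ?case
    proof (cases "S = {}")
      case False
      have "(\<Sum>x\<in>S. card {y\<in>S. x \<in> H y}) = (\<Sum>y\<in>S. card {x\<in>S. x \<in> H y})"
        by (rule sum_multicount_gen) (use less.prems in auto)
      also have "\<dots> \<le> (\<Sum>y\<in>S. h)"
        using less.prems by (intro sum_mono) (metis (mono_tags) card_mono le_trans mem_Collect_eq subsetI)
      finally have *: "(\<Sum>x\<in>S. card {y\<in>S. x \<in> H y}) \<le> (\<Sum>x\<in>S. h)" .
      have "\<exists>v\<in>S. card {y\<in>S. v \<in> H y} \<le> h"
      proof (rule ccontr)
        assume "\<not> ?thesis"
        then have "(\<Sum>x\<in>S. h) < (\<Sum>x\<in>S. card {y\<in>S. x \<in> H y})"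
          using less.prems False by (intro sum_strict_mono) auto
        then show False
          using * by simp
      qed
      then obtain v where v: "v \<in> S" "card {y\<in>S. v \<in> H y} \<le> h"
        by blast
      define R where "R = insert v (H v \<union> {y\<in>S. v \<in> H y})"
      have R: "finite R" "card R \<le> 2 * h + 1"
      proof -
        show "finite R"
          using less.prems v by (simp add: R_def)
        have "card R \<le> Suc (card (H v \<union> {y\<in>S. v \<in> H y}))"
          using less.prems v by (simp add: R_def card_insert_if)
        also have "\<dots> \<le> Suc (card (H v) + card {y\<in>S. v \<in> H y})"
          by (simp add: card_Un_le)
        finally have "card R \<le> Suc (card (H v) + card {y\<in>S. v \<in> H y})" .
        then show "card R \<le> 2 * h + 1"
          using less.prems(2)[OF v(1)] v(2) by simp
      qed
      have "card (S - R) < card S"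
        using less.prems(1) v(1) by (intro psubset_card_mono) (auto simp: R_def)
      then obtain T where T: "T \<subseteq> S - R" "card (S - R) \<le> (2 * h + 1) * card T"
          "\<forall>x\<in>T. \<forall>y\<in>T. x \<in> H y \<longrightarrow> x = y"
        using less.hyps[of "S - R"] less.prems by auto
      have "finite T" "v \<notin> T"
        using T(1) less.prems(1) by (auto simp: R_def intro: finite_subset)
      have "card S \<le> card (S - R) + card R"
        using card_Un_le[of "S - R" R] card_mono[of "S - R \<union> R" S] less.prems(1) R(1) by auto
      also have "\<dots> \<le> (2 * h + 1) * card (insert v T)"
        using T(2) R(2) \<open>finite T\<close> \<open>v \<notin> T\<close> by simp
      finally have "card S \<le> (2 * h + 1) * card (insert v T)" .
      moreover have "\<forall>x\<in>insert v T. \<forall>y\<in>insert v T. x \<in> H y \<longrightarrow> x = y"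
        using T by (auto simp: R_def)
      ultimately show ?thesis
        using T(1) v(1) by (intro exI[of _ "insert v T"]) auto
    qed auto
  qed
  then show thesis
    using that by blast
qed

section \<open>Generic representations by affine combinations\<close>

definition lin_comb :: "nat set \<Rightarrow> (nat \<Rightarrow> 'a::field) \<Rightarrow> (nat \<Rightarrow> nat \<Rightarrow> 'a) \<Rightarrow> nat \<Rightarrow> 'a" where
  "lin_comb C b x = (\<lambda>t. \<Sum>j\<in>C. b j * x j t)"

text \<open>Relations are only considered modulo a finite set \<open>W\<close>, which stands for the span of the vectors
  chosen earlier.\<close>

definition generic_representation ::
  "(nat \<Rightarrow> 'a::field) set \<Rightarrow> (nat \<Rightarrow> 'a) set \<Rightarrow> nat set \<Rightarrow> (nat \<Rightarrow> 'a) \<Rightarrow> (nat \<Rightarrow> 'a) \<Rightarrow> (nat \<Rightarrow> nat \<Rightarrow> 'a) \<Rightarrow> bool" where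
  "generic_representation S W C \<kappa> y x \<longleftrightarrow>
     (\<forall>j\<in>C. x j \<in> S) \<and> lin_comb C \<kappa> x = y \<and>
     (\<forall>b. lin_comb C b x \<in> W \<longrightarrow> (\<exists>r. \<forall>j\<in>C. b j = r * \<kappa> j))"

text \<open>Only the size of \<open>W\<close> is bounded, so \<open>W\<close> may depend on
  \<open>y\<close> and on all vectors chosen earlier. The values of \<open>Q\<close> that occur are
  independent of n.\<close>

definition generically_representable ::
  "(nat \<Rightarrow> 'a::field) set \<Rightarrow> nat \<Rightarrow> nat set \<Rightarrow> (nat \<Rightarrow> 'a) \<Rightarrow> (nat \<Rightarrow> 'a) \<Rightarrow> bool" where
  "generically_representable S Q C \<kappa> y \<longleftrightarrow>
     (\<forall>W. finite W \<and> card W \<le> Q \<longrightarrow> (\<exists>x. generic_representation S W C \<kappa> y x))"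

text \<open>The bound ranges over every \<open>S\<close>, hence also over the set of good points of
  a given set; this is what permits nesting.\<close>

definition almost_all :: "((nat \<Rightarrow> 'a::{field,finite}) set \<Rightarrow> (nat \<Rightarrow> 'a) \<Rightarrow> bool) \<Rightarrow> bool" where
  "almost_all R \<longleftrightarrow> (\<exists>B \<gamma>::real. 0 \<le> B \<and> 0 < \<gamma> \<and> \<gamma> < real (card (UNIV :: 'a set)) \<and>
     (\<forall>n S. S \<subseteq> vecs n \<longrightarrow> real (card {y\<in>S. \<not> R S y}) \<le> B * \<gamma> ^ n))"

section \<open>Calculus of exponentially small exceptional sets\<close>

lemma generically_representable_mono:
  fixes \<kappa> :: "nat \<Rightarrow> 'a::field"
  assumes "generically_representable S Q C \<kappa> y" "S \<subseteq> S'" "Q' \<le> Q"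
  shows "generically_representable S' Q' C \<kappa> y"
proof -
  have "generic_representation S' W C \<kappa> y x" if "generic_representation S W C \<kappa> y x" for W x
    using that assms(2) unfolding generic_representation_def by blast
  then show ?thesis
    using assms(1,3) unfolding generically_representable_def by (metis le_trans)
qed

lemma almost_all_mono:
  assumes "almost_all R" "\<And>n S y. S \<subseteq> vecs n \<Longrightarrow> y \<in> S \<Longrightarrow> R S y \<Longrightarrow> R' S y"
  shows "almost_all R'"
proof -
  obtain B \<gamma> :: real where *: "0 \<le> B" "0 < \<gamma>" "\<gamma> < real (card (UNIV :: 'a set))"
    "\<And>n S. S \<subseteq> vecs n \<Longrightarrow> real (card {y\<in>S. \<not> R S y}) \<le> B * \<gamma> ^ n"
    using assms(1) unfolding almost_all_def by blast
  have "real (card {y\<in>S. \<not> R' S y}) \<le> B * \<gamma> ^ n" if "S \<subseteq> vecs n" for n S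
  proof -
    have "finite S"
      using that finite_vecs finite_subset by blast
    then have "card {y\<in>S. \<not> R' S y} \<le> card {y\<in>S. \<not> R S y}"
      using assms(2) that by (intro card_mono) auto
    then show ?thesis
      using *(4)[OF that] by linarith
  qed
  then show ?thesis
    unfolding almost_all_def using * by blast
qed

text \<open>The second property is taken relative to the points with the first one, so that
  representing points can themselves be required to be good. The two exceptional sets simply add
  up.\<close>

lemma almost_all_nested:
  assumes "almost_all R1" "almost_all R2"
  shows "almost_all (\<lambda>S y. R1 S y \<and> R2 {z\<in>S. R1 S z} y)"
proof -
  obtain B1 \<gamma>1 :: real where 1: "0 \<le> B1" "0 < \<gamma>1" "\<gamma>1 < real (card (UNIV :: 'a set))"
    "\<And>n S. S \<subseteq> vecs n \<Longrightarrow> real (card {y\<in>S. \<not> R1 S y}) \<le> B1 * \<gamma>1 ^ n"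
    using assms(1) unfolding almost_all_def by blast
  obtain B2 \<gamma>2 :: real where 2: "0 \<le> B2" "0 < \<gamma>2" "\<gamma>2 < real (card (UNIV :: 'a set))"
    "\<And>n S. S \<subseteq> vecs n \<Longrightarrow> real (card {y\<in>S. \<not> R2 S y}) \<le> B2 * \<gamma>2 ^ n"
    using assms(2) unfolding almost_all_def by blast
  have "real (card {y\<in>S. \<not> (R1 S y \<and> R2 {z\<in>S. R1 S z} y)}) \<le> (B1 + B2) * (max \<gamma>1 \<gamma>2) ^ n"
    if "S \<subseteq> vecs n" for n S
  proof -
    let ?S = "{z\<in>S. R1 S z}"
    have fin: "finite S"
      using that finite_vecs finite_subset by blast
    have "{y\<in>S. \<not> (R1 S y \<and> R2 ?S y)} = {y\<in>S. \<not> R1 S y} \<union> {y\<in>?S. \<not> R2 ?S y}"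
      by auto
    then have "card {y\<in>S. \<not> (R1 S y \<and> R2 ?S y)} \<le> card {y\<in>S. \<not> R1 S y} + card {y\<in>?S. \<not> R2 ?S y}"
      by (simp only: card_Un_le)
    then have "real (card {y\<in>S. \<not> (R1 S y \<and> R2 ?S y)}) \<le> B1 * \<gamma>1 ^ n + B2 * \<gamma>2 ^ n"
      using 1(4)[OF that] 2(4)[of ?S n] that by force
    also have "\<dots> \<le> B1 * (max \<gamma>1 \<gamma>2) ^ n + B2 * (max \<gamma>1 \<gamma>2) ^ n"
      using 1 2 by (intro add_mono mult_left_mono power_mono) auto
    finally show ?thesis
      by (simp add: distrib_right)
  qed
  then show ?thesis
    unfolding almost_all_def using 1 2
    by (intro exI[of _ "B1 + B2"] exI[of _ "max \<gamma>1 \<gamma>2"]) auto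
qed

text \<open>Nesting yields the later properties only relative to a subset of \<open>S\<close>;
  monotonicity lifts them back to \<open>S\<close>.\<close>

lemma almost_all_Ball:
  assumes "finite I" "\<And>i. i \<in> I \<Longrightarrow> almost_all (R i)"
    and mono: "\<And>i S S' y. R i S y \<Longrightarrow> S \<subseteq> S' \<Longrightarrow> R i S' y"
  shows "almost_all (\<lambda>S y. \<forall>i\<in>I. R i S y)"
  using assms(1,2)
proof (induction I)
  case empty
  have "1 < real (card (UNIV :: 'b set))"
    using card_field_ge_2[where 'a = 'b] by simp
  then show ?case
    unfolding almost_all_def by (intro exI[of _ 0] exI[of _ 1]) simp
next
  case (insert i I)
  have "almost_all (\<lambda>S y. R i S y \<and> (\<forall>i'\<in>I. R i' {z\<in>S. R i S z} y))"
    using insert by (intro almost_all_nested[of "R i" "\<lambda>S y. \<forall>i'\<in>I. R i' S y"]) auto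
  then show ?case
    by (rule almost_all_mono) (auto intro: mono)
qed

text \<open>By monotonicity the bad points of \<open>S\<close> are also bad relative to the set they
  form, so it suffices to bound sets all of whose points are bad for the set itself.\<close>

lemma almost_allI:
  fixes R :: "(nat \<Rightarrow> 'a::{field,finite}) set \<Rightarrow> (nat \<Rightarrow> 'a) \<Rightarrow> bool" and \<gamma> B :: real
  assumes "0 \<le> B" "0 < \<gamma>" "\<gamma> < real (card (UNIV :: 'a set))"
    and "\<And>n T. T \<subseteq> vecs n \<Longrightarrow> (\<And>y. y \<in> T \<Longrightarrow> \<not> R T y) \<Longrightarrow> real (card T) \<le> B * \<gamma> ^ n"
    and mono: "\<And>S S' y. R S y \<Longrightarrow> S \<subseteq> S' \<Longrightarrow> R S' y"
  shows "almost_all R"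
proof -
  have "real (card {y\<in>S. \<not> R S y}) \<le> B * \<gamma> ^ n" if "S \<subseteq> vecs n" for n S
    using that mono by (intro assms(4)) (auto intro: mono)
  then show ?thesis
    unfolding almost_all_def using assms(1-3) by blast
qed

text \<open>The blocking set: it contains every x for which some e x + r y with e nonzero lies in
  \<open>W\<close>. The two scalars cost a factor q^2, independently of n.\<close>

definition combos :: "(nat \<Rightarrow> 'a::field) set \<Rightarrow> (nat \<Rightarrow> 'a) \<Rightarrow> (nat \<Rightarrow> 'a) set" where
  "combos W y = (\<lambda>(w, s, r) t. s * w t + r * y t) ` (W \<times> UNIV \<times> UNIV)"

lemma combosI:
  assumes "e \<noteq> 0" "(\<lambda>t. e * x t + r * y t) \<in> W"
  shows "x \<in> combos W y"
proof -
  have "x = (\<lambda>t. (1 / e) * (e * x t + r * y t) + (- r / e) * y t)"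
    using assms(1) by (auto simp: field_simps)
  then show ?thesis
    unfolding combos_def using assms(2)
    by (intro image_eqI[of _ _ "(\<lambda>t. e * x t + r * y t, 1 / e, - r / e)"]) auto
qed

lemma finite_combos: "finite W \<Longrightarrow> finite (combos W (y :: nat \<Rightarrow> 'a::{field,finite}))"
  by (simp add: combos_def)

lemma card_combos:
  fixes y :: "nat \<Rightarrow> 'a::{field,finite}"
  assumes "finite W" "card W \<le> Q"
  shows "card (combos W y) \<le> Q * (card (UNIV :: 'a set) * card (UNIV :: 'a set))"
proof -
  have "card (combos W y) \<le> card (W \<times> (UNIV :: 'a set) \<times> (UNIV :: 'a set))"
    unfolding combos_def using assms by (intro card_image_le) simp
  also have "\<dots> = card W * (card (UNIV :: 'a set) * card (UNIV :: 'a set))"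
    by (simp only: card_cartesian_product)
  finally show ?thesis
    using assms(2) by (meson le_trans mult_le_mono1)
qed

text \<open>If all points of \<open>T\<close> are bad, each \<open>y\<close> has a blocking set
  \<open>H y\<close>, and a set independent for these contains only trivial solutions. Slice rank
  bounds it by \<open>3 * \<gamma> ^ n\<close>, and passing from \<open>T\<close> to it costs the
  factor \<open>2 * h + 1\<close>.\<close>

lemma almost_all_generically_representable_pair:
  fixes \<kappa> :: "nat \<Rightarrow> 'a::{field,finite}"
  assumes ij: "i \<noteq> j" and nz: "\<kappa> i \<noteq> 0" "\<kappa> j \<noteq> 0" and sum: "\<kappa> i + \<kappa> j = 1"
  shows "almost_all (\<lambda>S. generically_representable S Q {i, j} \<kappa>)"
proof -
  obtain \<gamma> :: real where \<gamma>: "0 < \<gamma>" "\<gamma> < real (card (UNIV :: 'a set))"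
    and bound: "\<And>n T. T \<subseteq> (vecs n :: (nat \<Rightarrow> 'a) set) \<Longrightarrow>
      \<forall>x\<in>T. \<forall>y\<in>T. \<forall>z\<in>T. (\<lambda>t. \<kappa> i * x t + \<kappa> j * y t) = z \<longrightarrow> x = y \<and> y = z \<Longrightarrow>
      real (card T) \<le> 3 * \<gamma> ^ n"
    using no_nontrivial_solution_bound[OF sum] by blast
  define h where "h = Q * (card (UNIV :: 'a set) * card (UNIV :: 'a set))"
  show ?thesis
  proof (rule almost_allI[where B = "real (2 * h + 1) * 3"])
    show "generically_representable S' Q {i, j} \<kappa> y"
      if "generically_representable S Q {i, j} \<kappa> y" "S \<subseteq> S'" for S S' y
      using that by (rule generically_representable_mono) simp
    fix n and T :: "(nat \<Rightarrow> 'a) set"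
    assume T: "T \<subseteq> vecs n" and bad: "\<And>y. y \<in> T \<Longrightarrow> \<not> generically_representable T Q {i, j} \<kappa> y"
    have "\<forall>y\<in>T. \<exists>W. finite W \<and> card W \<le> Q \<and> (\<forall>x. \<not> generic_representation T W {i, j} \<kappa> y x)"
      using bad by (simp add: generically_representable_def)
    then obtain W where W: "\<And>y. y \<in> T \<Longrightarrow> finite (W y) \<and> card (W y) \<le> Q"
      and noW: "\<And>y x. y \<in> T \<Longrightarrow> \<not> generic_representation T (W y) {i, j} \<kappa> y x"
      by metis
    define H where "H = (\<lambda>y. combos (W y) y)"
    have H: "finite (H y) \<and> card (H y) \<le> h" if "y \<in> T" for y
      using finite_combos[of "W y" y] card_combos[of "W y" Q y] W[OF that]
      by (simp add: H_def h_def)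
    have "finite T"
      using T finite_vecs finite_subset by blast
    then obtain T' where T': "T' \<subseteq> T" "card T \<le> (2 * h + 1) * card T'"
        "\<And>x y. x \<in> T' \<Longrightarrow> y \<in> T' \<Longrightarrow> x \<in> H y \<Longrightarrow> x = y"
      using independent_set_bounded_outdegree[of T H h] H by blast
    have "real (card T') \<le> 3 * \<gamma> ^ n"
    proof (rule bound, use T T' in blast, intro ballI impI)
      fix x y z assume xyz: "x \<in> T'" "y \<in> T'" "z \<in> T'" "(\<lambda>t. \<kappa> i * x t + \<kappa> j * y t) = z"
      have z: "z t = \<kappa> i * x t + \<kappa> j * y t" for t
        using xyz(4) by auto
      let ?x = "\<lambda>l. if l = i then x else y"
      have lc: "lin_comb {i, j} b ?x = (\<lambda>t. b i * x t + b j * y t)" for b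
        using ij by (simp add: lin_comb_def)
      have x_T: "\<forall>l\<in>{i, j}. ?x l \<in> T"
        using xyz T' by auto
      have "\<not> generic_representation T (W z) {i, j} \<kappa> z ?x"
        using xyz T' by (intro noW) auto
      then obtain b where b: "(\<lambda>t. b i * x t + b j * y t) \<in> W z" "\<nexists>r. \<forall>l\<in>{i, j}. b l = r * \<kappa> l"
        unfolding generic_representation_def lc using x_T xyz(4) by blast
      \<comment> \<open>Coefficient of x after y has been eliminated from the relation by means of
        z. It vanishes only if b is proportional to \<kappa>.\<close>
      define e where "e = b i - b j / \<kappa> j * \<kappa> i"
      have "e \<noteq> 0"
      proof
        assume "e = 0"
        then have "\<forall>l\<in>{i, j}. b l = (b j / \<kappa> j) * \<kappa> l"
          using nz by (simp add: e_def)
        then show False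
          using b(2) by blast
      qed
      have "(\<lambda>t. e * x t + (b j / \<kappa> j) * z t) = (\<lambda>t. b i * x t + b j * y t)"
      proof
        fix t
        show "e * x t + (b j / \<kappa> j) * z t = b i * x t + b j * y t"
          using nz unfolding z[of t] by (simp add: e_def field_simps)
      qed
      then have "x \<in> H z"
        unfolding H_def using b(1) \<open>e \<noteq> 0\<close> by (intro combosI[of e x "b j / \<kappa> j"]) simp_all
      then have "x = z"
        using T'(3) xyz by blast
      have "y t = z t" for t
      proof -
        have "\<kappa> i * z t + \<kappa> j * y t = z t"
          using z[of t] unfolding \<open>x = z\<close> by (rule sym)
        then have "\<kappa> i * z t + \<kappa> j * y t = (\<kappa> i + \<kappa> j) * z t"
          by (simp only: sum mult_1)
        then have "\<kappa> j * y t = \<kappa> j * z t"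
          by (simp only: distrib_right add_left_cancel)
        then show ?thesis
          using nz by simp
      qed
      then show "x = y \<and> y = z"
        using \<open>x = z\<close> by auto
    qed
    have "real (card T) \<le> real ((2 * h + 1) * card T')"
      using T'(2) by linarith
    also have "\<dots> = real (2 * h + 1) * real (card T')"
      by (rule of_nat_mult)
    also have "\<dots> \<le> real (2 * h + 1) * (3 * \<gamma> ^ n)"
      using \<open>real (card T') \<le> 3 * \<gamma> ^ n\<close> by (intro mult_left_mono) auto
    finally show "real (card T) \<le> real (2 * h + 1) * 3 * \<gamma> ^ n"
      by (simp only: mult.assoc)
  qed (use \<gamma> in simp_all)
qed

text \<open>By pigeonhole some value \<open>y + x\<^sub>k\<close> is attained very often, so it is also a sum
  \<open>x\<^sub>i + x\<^sub>j\<close> with \<open>x\<^sub>i\<close> generic.\<close>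

lemma almost_all_generically_representable_parallelogram:
  fixes \<kappa> :: "nat \<Rightarrow> 'a::{field,finite}"
  assumes ijk: "i \<noteq> j" "i \<noteq> k" "j \<noteq> k" and \<kappa>: "\<kappa> i = 1" "\<kappa> j = 1" "\<kappa> k = -1"
  shows "almost_all (\<lambda>S. generically_representable S Q {i, j, k} \<kappa>)"
proof -
  define q where "q = card (UNIV :: 'a set)"
  have q: "q \<ge> 2"
    unfolding q_def by (rule card_field_ge_2)
  \<comment> \<open>\<open>h1\<close> bounds the points blocked by \<open>W y\<close> and y, and
    \<open>h2\<close> those blocked once a further point is added to the relation.\<close>
  define h1 where "h1 = Q * (q * q)"
  define h2 where "h2 = h1 * (q * q)"
  show ?thesis
  \<comment> \<open>Base sqrt q, because the double count bounds the square of \<open>card T\<close>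
    by a constant multiple of q^n.\<close>
  proof (rule almost_allI[where B = "sqrt (real (h1 + h2))" and \<gamma> = "sqrt (real q)"])
    show "sqrt (real q) < real (card (UNIV :: 'a set))"
    proof -
      have "real q < real q * real q"
        using q by simp
      then have "sqrt (real q) < sqrt ((real q)\<^sup>2)"
        by (intro real_sqrt_less_mono) (simp add: power2_eq_square)
      then show ?thesis
        by (simp add: q_def)
    qed
    show "generically_representable S' Q {i, j, k} \<kappa> y"
      if "generically_representable S Q {i, j, k} \<kappa> y" "S \<subseteq> S'" for S S' y
      using that by (rule generically_representable_mono) simp
    fix n and T :: "(nat \<Rightarrow> 'a) set"
    assume T: "T \<subseteq> vecs n" and bad: "\<And>y. y \<in> T \<Longrightarrow> \<not> generically_representable T Q {i, j, k} \<kappa> y"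
    have "\<forall>y\<in>T. \<exists>W. finite W \<and> card W \<le> Q \<and> (\<forall>x. \<not> generic_representation T W {i, j, k} \<kappa> y x)"
      using bad by (simp add: generically_representable_def)
    then obtain W where W: "\<And>y. y \<in> T \<Longrightarrow> finite (W y) \<and> card (W y) \<le> Q"
      and noW: "\<And>y x. y \<in> T \<Longrightarrow> \<not> generic_representation T (W y) {i, j, k} \<kappa> y x"
      by metis
    define H where "H = (\<lambda>y. combos (W y) y)"
    have H: "finite (H y)" "card (H y) \<le> h1" if "y \<in> T" for y
      using finite_combos[of "W y" y] card_combos[of "W y" Q y] W[OF that]
      by (simp_all add: H_def h1_def q_def)
    have fin: "finite T"
      using T finite_vecs finite_subset by blast
    \<comment> \<open>Pairs (y, x_k) with x_k not blocked for y. Each y loses at most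
      \<open>h1\<close> partners, so for large \<open>T\<close> some sum y + x_k would be attained
      by more than \<open>h2\<close> pairs.\<close>
    define P where "P = (SIGMA y:T. T - H y)"
    define f where "f = (\<lambda>(y, x) (t::nat). y t + x t :: 'a)"
    have finP: "finite P"
      using fin by (simp add: P_def)
    have cN: "card (vecs n :: (nat \<Rightarrow> 'a) set) = q ^ n"
      unfolding q_def by (rule card_vecs)
    have "card P \<le> h2 * q ^ n"
    proof -
      have fP: "f \<in> P \<rightarrow> vecs n"
      proof
        fix p assume "p \<in> P"
        then have "fst p \<in> vecs n" "snd p \<in> vecs n"
          using T by (auto simp: P_def)
        then show "f p \<in> vecs n"
          by (simp add: f_def vecs_def case_prod_unfold)
      qed
      have "(\<lambda>_. 0) \<in> (vecs n :: (nat \<Rightarrow> 'a) set)"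
        by (simp add: vecs_def)
      then have "(vecs n :: (nat \<Rightarrow> 'a) set) \<noteq> {}"
        by blast
      then obtain v where v: "v \<in> vecs n" "card P \<le> card (f -` {v} \<inter> P) * card (vecs n :: (nat \<Rightarrow> 'a) set)"
        using pigeonhole_card[OF fP finP finite_vecs] by blast
      define A where "A = f -` {v} \<inter> P"
      have "card A \<le> h2"
      proof (cases "A = {}")
        case False
        then obtain y xk where yxk: "(y, xk) \<in> A"
          by auto
        then have *: "y \<in> T" "xk \<in> T" "xk \<notin> H y" "\<And>t. v t = y t + xk t"
          by (auto simp: A_def P_def f_def)
        define H2 where "H2 = combos (H y) xk"
        have H2: "finite H2" "card H2 \<le> h2"
          using finite_combos[of "H y" xk] card_combos[of "H y" h1 xk] H[OF *(1)]
          by (simp_all add: H2_def h2_def q_def)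
        \<comment> \<open>With one pair (y, x_k) of the fibre fixed, every pair (x_i, x_j) of the
          fibre gives y = x_i + x_j - x_k. Since y is bad, this representation satisfies an extra
          relation b, and that is possible only for x_i in \<open>H2\<close>.\<close>
        have "fst ` A \<subseteq> H2"
        proof (rule ccontr)
          assume "\<not> ?thesis"
          then obtain xi xj where A: "(xi, xj) \<in> A" and xi: "xi \<notin> H2"
            by force
          have T3: "xi \<in> T" "xj \<in> T" and veq: "\<And>t. v t = xi t + xj t"
            using A by (auto simp: A_def P_def f_def)
          define x where "x = (\<lambda>l. if l = i then xi else if l = j then xj else xk)"
          have lc: "lin_comb {i, j, k} b x = (\<lambda>t. b i * xi t + b j * xj t + b k * xk t)" for b
            using ijk by (simp add: lin_comb_def x_def add.assoc)
          have xj: "xj t = y t + xk t - xi t" for t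
            using veq[of t] *(4)[of t] by (simp add: algebra_simps)
          have mem: "\<forall>l\<in>{i, j, k}. x l \<in> T"
            using T3 * by (auto simp: x_def)
          have "lin_comb {i, j, k} \<kappa> x = y"
            unfolding lc by (simp add: \<kappa> xj)
          then obtain b where b: "lin_comb {i, j, k} b x \<in> W y" "\<nexists>r. \<forall>l\<in>{i, j, k}. b l = r * \<kappa> l"
            using noW[OF *(1), of x] mem unfolding generic_representation_def by blast
          have b1: "(\<lambda>t. b i * xi t + b j * xj t + b k * xk t) \<in> W y"
            using b(1) by (simp only: lc)
          \<comment> \<open>After eliminating x_j the relation reads (b_i - b_j) x_i + (b_j + b_k)
            x_k + b_j y. A nonzero first coefficient would put x_i into \<open>H2\<close>; with it
            gone, a nonzero second one would put x_k into \<open>H y\<close>. So b is proportional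
            to \<kappa>.\<close>
          have "b i = b j"
          proof (rule ccontr)
            assume "b i \<noteq> b j"
            then have ne: "b i - b j \<noteq> 0"
              by simp
            have "(\<lambda>t. 1 * ((b i - b j) * xi t + (b j + b k) * xk t) + b j * y t) =
                (\<lambda>t. b i * xi t + b j * xj t + b k * xk t)"
              by (simp add: xj algebra_simps)
            then have "(\<lambda>t. (b i - b j) * xi t + (b j + b k) * xk t) \<in> combos (W y) y"
              using b1 by (intro combosI[of 1 _ "b j"]) simp_all
            then have "xi \<in> H2"
              unfolding H2_def H_def using ne by (intro combosI[of "b i - b j" _ "b j + b k" xk]) simp_all
            then show False
              using xi by simp
          qed
          have "b k = - b j"
          proof (rule ccontr)
            assume "b k \<noteq> - b j"
            then have ne: "b j + b k \<noteq> 0"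
              by (metis add.commute eq_neg_iff_add_eq_0)
            have "(\<lambda>t. (b j + b k) * xk t + b j * y t) = (\<lambda>t. b i * xi t + b j * xj t + b k * xk t)"
              by (simp add: xj algebra_simps \<open>b i = b j\<close>)
            then have "xk \<in> H y"
              unfolding H_def using ne b1 by (intro combosI[of "b j + b k" _ "b j"]) simp_all
            then show False
              using *(3) by simp
          qed
          then have "\<forall>l\<in>{i, j, k}. b l = b j * \<kappa> l"
            using \<open>b i = b j\<close> \<kappa> by auto
          then show False
            using b(2) by blast
        qed
        moreover have "inj_on fst A"
        proof (rule inj_onI, clarify)
          fix x1 x2 x1' x2' assume "(x1, x2) \<in> A" "(x1', x2') \<in> A" "fst (x1, x2) = fst (x1', x2')"
          then have *: "f (x1, x2) = f (x1', x2')" "x1 = x1'"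
            by (simp_all add: A_def)
          have "x2 t = x2' t" for t
            using fun_cong[OF *(1), of t] *(2) by (simp add: f_def)
          then show "x1 = x1' \<and> x2 = x2'"
            using *(2) by blast
        qed
        ultimately show ?thesis
          using card_mono[of H2 "fst ` A"] H2 by (simp add: card_image)
      qed simp
      then show ?thesis
        using v(2) unfolding cN A_def by (meson le_trans mult_le_mono1)
    qed
    moreover have "card T * card T \<le> card P + card T * h1"
    proof -
      have "card P = (\<Sum>y\<in>T. card (T - H y))"
        using fin by (simp add: P_def)
      moreover have "(\<Sum>y\<in>T. card T) \<le> (\<Sum>y\<in>T. card (T - H y) + h1)"
      proof (rule sum_mono)
        fix y assume y: "y \<in> T"
        show "card T \<le> card (T - H y) + h1"
          using H[OF y] diff_card_le_card_Diff[of "H y" T] by linarith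
      qed
      ultimately show ?thesis
        by (simp add: sum.distrib)
    qed
    moreover have "card T \<le> q ^ n"
      using card_mono[OF finite_vecs T] by (simp add: cN)
    ultimately have "card T * card T \<le> h2 * q ^ n + q ^ n * h1"
      by (meson add_mono le_trans mult_le_mono1)
    then have "card T * card T \<le> (h1 + h2) * q ^ n"
      by (simp add: algebra_simps)
    then have "(real (card T))\<^sup>2 \<le> real (h1 + h2) * real q ^ n"
      unfolding power2_eq_square by (metis of_nat_le_iff of_nat_mult of_nat_power)
    then have "sqrt ((real (card T))\<^sup>2) \<le> sqrt (real (h1 + h2) * real q ^ n)"
      by (rule real_sqrt_le_mono)
    then show "real (card T) \<le> sqrt (real (h1 + h2)) * sqrt (real q) ^ n"
      by (simp add: real_sqrt_mult real_sqrt_power)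
  qed (use q in simp_all)
qed

text \<open>The indices in \<open>D\<close> are first treated as the single index \<open>d\<close>
  with coefficient \<open>s\<close>; the point found there is good and is then expanded over
  \<open>D\<close> with the coefficients divided by \<open>s\<close>. The inner representation has
  to be generic modulo the span of the points over \<open>A\<close> as well, which explains its
  larger budget.\<close>

lemma generically_representable_merge:
  fixes \<kappa> :: "nat \<Rightarrow> 'a::{field,finite}"
  assumes "finite A" "finite D" "A \<inter> D = {}" "d \<in> D" and s: "s = sum \<kappa> D" "s \<noteq> 0"
    and y: "generically_representable {z\<in>S. generically_representable S (Q * card (UNIV :: 'a set) ^ card A) D (\<lambda>j. \<kappa> j / s) z}
      Q (insert d A) (\<kappa>(d := s)) y"
  shows "generically_representable S Q (A \<union> D) \<kappa> y"
  unfolding generically_representable_def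
proof (intro allI impI)
  fix W :: "(nat \<Rightarrow> 'a) set"
  assume W: "finite W \<and> card W \<le> Q"
  have dA: "d \<notin> A"
    using assms(3,4) by blast
  let ?Q = "Q * card (UNIV :: 'a set) ^ card A"
  let ?S = "{z\<in>S. generically_representable S ?Q D (\<lambda>j. \<kappa> j / s) z}"
  obtain x where x: "generic_representation ?S W (insert d A) (\<kappa>(d := s)) y x"
    using y W unfolding generically_representable_def by blast
  \<comment> \<open>What the \<open>D\<close>-part of a relation can be once its
    \<open>A\<close>-part has been moved to the other side. Coefficients are taken in
    \<open>PiE\<close> to make the count q^card A.\<close>
  define W' where "W' = (\<lambda>(w, b) t. w t - lin_comb A b x t) ` (W \<times> PiE A (\<lambda>_. UNIV))"
  have W': "finite W'" "card W' \<le> ?Q"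
  proof -
    have fin: "finite (W \<times> PiE A (\<lambda>_. UNIV :: 'a set))"
      using W assms(1) by (intro finite_cartesian_product finite_PiE) auto
    then show "finite W'"
      unfolding W'_def by (rule finite_imageI)
    have "card W' \<le> card (W \<times> PiE A (\<lambda>_. UNIV :: 'a set))"
      unfolding W'_def using fin by (rule card_image_le)
    then show "card W' \<le> ?Q"
      using W assms(1) by (simp add: card_cartesian_product card_PiE) (meson le_trans mult_le_mono1)
  qed
  have xd: "x d \<in> S" "generically_representable S ?Q D (\<lambda>j. \<kappa> j / s) (x d)"
    using x unfolding generic_representation_def by auto
  then obtain x' where x': "generic_representation S W' D (\<lambda>j. \<kappa> j / s) (x d) x'"
    using W' unfolding generically_representable_def by blast
  define z where "z = (\<lambda>j. if j \<in> D then x' j else x j)"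
  have lc: "lin_comb (A \<union> D) b z t = lin_comb A b x t + lin_comb D b x' t" for b t
  proof -
    have "(\<Sum>j\<in>A. b j * z j t) = (\<Sum>j\<in>A. b j * x j t)"
      using assms(3) by (intro sum.cong) (auto simp: z_def)
    moreover have "(\<Sum>j\<in>D. b j * z j t) = (\<Sum>j\<in>D. b j * x' j t)"
      by (intro sum.cong) (auto simp: z_def)
    ultimately show ?thesis
      unfolding lin_comb_def using assms by (simp add: sum.union_disjoint)
  qed
  have lc_scale: "lin_comb D b x' t = r * x d t" if "\<forall>j\<in>D. b j = r * (\<kappa> j / s)" for b r t
  proof -
    have "lin_comb D b x' t = (\<Sum>j\<in>D. r * (\<kappa> j / s * x' j t))"
      unfolding lin_comb_def using that by (intro sum.cong) (auto simp: mult.assoc)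
    also have "\<dots> = r * lin_comb D (\<lambda>j. \<kappa> j / s) x' t"
      by (simp only: lin_comb_def sum_distrib_left)
    finally show ?thesis
      using x' by (simp add: generic_representation_def)
  qed
  have lc_insert: "lin_comb (insert d A) b x t = b d * x d t + lin_comb A b x t" for b t
    using assms(1) dA by (simp add: lin_comb_def)
  have lc_upd: "lin_comb A (b(d := r)) x t = lin_comb A b x t" for b r t
    unfolding lin_comb_def using dA by (intro sum.cong) auto
  show "\<exists>x. generic_representation S W (A \<union> D) \<kappa> y x"
    unfolding generic_representation_def
  proof (intro exI[of _ z] conjI allI impI)
    show "\<forall>j\<in>A \<union> D. z j \<in> S"
      using x x' unfolding generic_representation_def z_def by auto
    show "lin_comb (A \<union> D) \<kappa> z = y"
    proof
      fix t
      have "y t = lin_comb (insert d A) (\<kappa>(d := s)) x t"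
        using x by (simp add: generic_representation_def)
      then show "lin_comb (A \<union> D) \<kappa> z t = y t"
        using lc_scale[of \<kappa> s t] s(2) by (simp add: lc lc_insert lc_upd)
    qed
    fix b assume b: "lin_comb (A \<union> D) b z \<in> W"
    have "lin_comb D b x' = (\<lambda>t. lin_comb (A \<union> D) b z t - lin_comb A (restrict b A) x t)"
    proof
      fix t
      have "lin_comb A (restrict b A) x t = lin_comb A b x t"
        unfolding lin_comb_def by (intro sum.cong) auto
      then show "lin_comb D b x' t = lin_comb (A \<union> D) b z t - lin_comb A (restrict b A) x t"
        by (simp add: lc)
    qed
    then have "lin_comb D b x' \<in> W'"
      unfolding W'_def using b
      by (intro image_eqI[of _ _ "(lin_comb (A \<union> D) b z, restrict b A)"]) auto
    then obtain r where r: "\<forall>j\<in>D. b j = r * (\<kappa> j / s)"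
      using x' unfolding generic_representation_def by blast
    \<comment> \<open>On \<open>D\<close> the relation is r times the representation of
      \<open>x d\<close>, so it collapses to a relation of the outer representation, whose
      genericity now applies.\<close>
    have "lin_comb (insert d A) (b(d := r)) x = lin_comb (A \<union> D) b z"
      by (intro ext) (simp add: lc lc_insert lc_upd lc_scale[OF r])
    then obtain r' where r': "\<forall>j\<in>insert d A. (b(d := r)) j = r' * (\<kappa>(d := s)) j"
      using x b unfolding generic_representation_def by metis
    have "b j = r' * \<kappa> j" if "j \<in> A \<union> D" for j
    proof (cases "j \<in> D")
      case True
      have "r = r' * s"
        using r' by simp
      then show ?thesis
        using r True s(2) by simp
    next
      case False
      then have "j \<in> A" "j \<noteq> d"
        using that dA by auto
      then show ?thesis
        using r' by (metis fun_upd_other insertCI)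
    qed
    then show "\<exists>r. \<forall>j\<in>A \<union> D. b j = r * \<kappa> j"
      by blast
  qed
qed

lemma almost_all_generically_representable_merge:
  fixes \<kappa> :: "nat \<Rightarrow> 'a::{field,finite}"
  assumes "finite A" "finite D" "A \<inter> D = {}" "d \<in> D" "s = sum \<kappa> D" "s \<noteq> 0"
    and D: "\<And>Q. almost_all (\<lambda>S. generically_representable S Q D (\<lambda>j. \<kappa> j / s))"
    and A: "almost_all (\<lambda>S. generically_representable S Q (insert d A) (\<kappa>(d := s)))"
  shows "almost_all (\<lambda>S. generically_representable S Q (A \<union> D) \<kappa>)"
  by (rule almost_all_mono[OF almost_all_nested[OF D A]])
    (blast intro: generically_representable_merge[OF assms(1-6)])

text \<open>Induction on the number of indices, each step replacing two or three of them by one with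
  the sum of their coefficients. Dividing the group by its nonzero sum makes it an affine
  combination again.\<close>

theorem almost_all_generically_representable:
  fixes \<kappa> :: "nat \<Rightarrow> 'a::{field,finite}"
  assumes "finite C" "\<And>j. j \<in> C \<Longrightarrow> \<kappa> j \<noteq> 0" "sum \<kappa> C = 1"
  shows "almost_all (\<lambda>S. generically_representable S Q C \<kappa>)"
  using assms
proof (induction "card C" arbitrary: C \<kappa> Q rule: less_induct)
  case less
  note finC = less.prems(1) and nz = less.prems(2) and sum1 = less.prems(3)
  have merge: ?case if D: "D \<subseteq> C" "d \<in> D" "2 \<le> card D" "sum \<kappa> D \<noteq> 0"
    and DQ: "\<And>Q. almost_all (\<lambda>S. generically_representable S Q D (\<lambda>j. \<kappa> j / sum \<kappa> D))" for D d
  proof -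
    have finD: "finite D"
      using D finC finite_subset by blast
    have card: "card C = card (C - D) + card D"
      using D finC card_Diff_subset[OF finD D(1)] card_mono[OF finC D(1)] by simp
    have "almost_all (\<lambda>S. generically_representable S Q (insert d (C - D)) (\<kappa>(d := sum \<kappa> D)))"
    proof (rule less.hyps)
      show "card (insert d (C - D)) < card C"
        using D finC card by (simp add: card_insert_if)
      show "sum (\<kappa>(d := sum \<kappa> D)) (insert d (C - D)) = 1"
      proof -
        have "sum (\<kappa>(d := sum \<kappa> D)) (insert d (C - D)) = sum \<kappa> D + sum \<kappa> (C - D)"
          using D finC by (subst sum.insert) (auto intro!: sum.cong)
        then show ?thesis
          using sum.subset_diff[OF D(1) finC, of \<kappa>] sum1 by (simp add: add.commute)
      qed
      show "(\<kappa>(d := sum \<kappa> D)) j \<noteq> 0" if "j \<in> insert d (C - D)" for j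
        using that D(4) nz by auto
    qed (use finC in simp)
    then have "almost_all (\<lambda>S. generically_representable S Q ((C - D) \<union> D) \<kappa>)"
      using D finC finD DQ
      by (intro almost_all_generically_representable_merge[of "C - D" D d "sum \<kappa> D"]) auto
    then show ?thesis
      using D by (simp add: Un_absorb2)
  qed
  have "C \<noteq> {}"
    using sum1 by auto
  consider (one) i where "C = {i}"
    | (pair) i j where "i \<in> C" "j \<in> C" "i \<noteq> j" "\<kappa> i + \<kappa> j \<noteq> 0"
    | (no_pair) i j where "i \<in> C" "j \<in> C" "i \<noteq> j" "\<forall>i\<in>C. \<forall>j\<in>C. i \<noteq> j \<longrightarrow> \<kappa> i + \<kappa> j = 0"
    using \<open>C \<noteq> {}\<close> by blast
  then show ?case
  proof cases
    case one
    have "generically_representable S Q C \<kappa> y" if "y \<in> S" for S y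
      unfolding generically_representable_def generic_representation_def
      using that sum1 one by (intro allI impI exI[of _ "\<lambda>_. y"]) (auto simp: lin_comb_def)
    moreover have "almost_all (\<lambda>S (y :: nat \<Rightarrow> 'a). True)"
      using almost_all_Ball[of "{}"] by simp
    ultimately show ?thesis
      by (elim almost_all_mono)
  next
    case pair
    show ?thesis
    proof (rule merge[of "{i, j}" i])
      fix Q
      have "\<kappa> i / (\<kappa> i + \<kappa> j) + \<kappa> j / (\<kappa> i + \<kappa> j) = 1"
        using pair(4) by (simp flip: add_divide_distrib)
      then show "almost_all (\<lambda>S. generically_representable S Q {i, j} (\<lambda>l. \<kappa> l / sum \<kappa> {i, j}))"
        using pair nz by (intro almost_all_generically_representable_pair) auto
    qed (use pair in auto)
  next
    case no_pair
    \<comment> \<open>Two cancelling coefficients cannot have sum 1, so there is a third index. The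
      pairwise cancellation then makes \<kappa> equal on the three indices, and equal to its own
      negative.\<close>
    have "C \<noteq> {i, j}"
      using no_pair sum1 by auto
    then obtain k where k: "k \<in> C" "k \<noteq> i" "k \<noteq> j"
      using no_pair by blast
    have neg: "\<kappa> i = - \<kappa> j" "\<kappa> k = - \<kappa> j" "\<kappa> k = - \<kappa> i"
      using no_pair k by (auto simp: eq_neg_iff_add_eq_0)
    then have eq: "\<kappa> j = \<kappa> i" "\<kappa> k = \<kappa> i" "- \<kappa> i = \<kappa> i"
      by simp_all
    have sum3: "sum \<kappa> {i, j, k} = \<kappa> i"
    proof -
      have "sum \<kappa> {i, j, k} = \<kappa> i + (\<kappa> j + \<kappa> k)"
        using no_pair k by simp
      also have "\<kappa> j + \<kappa> k = 0"
        using neg by simp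
      finally show ?thesis
        by simp
    qed
    have "\<kappa> i \<noteq> 0"
      using nz no_pair by blast
    \<comment> \<open>In characteristic 2 the scaled coefficients 1, 1, 1 are also 1, 1, -1, as the
      parallelogram requires.\<close>
    then have "(- 1 :: 'a) = 1"
      using eq(3) by (metis divide_self minus_divide_left)
    show ?thesis
    proof (rule merge[of "{i, j, k}" i])
      fix Q
      show "almost_all (\<lambda>S. generically_representable S Q {i, j, k} (\<lambda>l. \<kappa> l / sum \<kappa> {i, j, k}))"
        unfolding sum3 using no_pair k \<open>\<kappa> i \<noteq> 0\<close> \<open>- 1 = 1\<close>
        by (intro almost_all_generically_representable_parallelogram) (auto simp: eq(1,2))
    qed (use no_pair k sum3 \<open>\<kappa> i \<noteq> 0\<close> in auto)
  qed
qed

section \<open>Fibres of linear systems\<close>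

definition independent_rows :: "'i set \<Rightarrow> 'x set \<Rightarrow> ('i \<Rightarrow> 'x \<Rightarrow> 'a::field) \<Rightarrow> bool" where
  "independent_rows I L p \<longleftrightarrow>
     (\<forall>c. (\<forall>x\<in>L. (\<Sum>i\<in>I. c i * p i x) = 0) \<longrightarrow> (\<forall>i\<in>I. c i = 0))"

text \<open>Row rank is at most column rank. \<open>P\<close> is a maximal set of linearly
  independent columns. If it were smaller than \<open>I\<close>, a nonzero combination of the rows
  would vanish on \<open>P\<close>; since every other column depends on \<open>P\<close>, it would
  vanish on all of \<open>L\<close>.\<close>

lemma independent_rows_pivots:
  fixes p :: "'i \<Rightarrow> 'x \<Rightarrow> 'a::{field,finite}"
  assumes "finite I" "finite L" and indep: "independent_rows I L p"
  shows "\<exists>P\<subseteq>L. card I \<le> card P \<and>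
    (\<forall>w. (\<forall>x\<in>L - P. w x = 0) \<longrightarrow> (\<forall>i\<in>I. (\<Sum>x\<in>L. w x * p i x) = 0) \<longrightarrow> (\<forall>x\<in>L. w x = 0))"
proof -
  define ker where "ker = (\<lambda>w. \<forall>i\<in>I. (\<Sum>x\<in>L. w x * p i x) = 0)"
  define zero where "zero = (\<lambda>(X::'x set) w. \<forall>x\<in>X. w x = (0::'a))"
  define inj where "inj = (\<lambda>P. P \<subseteq> L \<and> (\<forall>w. zero (L - P) w \<longrightarrow> ker w \<longrightarrow> zero L w))"
  have "inj {}"
    by (simp add: inj_def zero_def)
  moreover have "\<forall>P. inj P \<longrightarrow> card P < Suc (card L)"
    using assms(2) by (auto simp: inj_def less_Suc_eq_le intro: card_mono)
  ultimately obtain P where P: "inj P" "\<And>P'. inj P' \<Longrightarrow> card P' \<le> card P"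
    using ex_has_greatest_nat[of inj "{}" card] by blast
  have PL: "P \<subseteq> L" "finite P"
    using P(1) assms(2) by (auto simp: inj_def intro: finite_subset)
  have "card I \<le> card P"
  proof (rule ccontr)
    assume "\<not> ?thesis"
    then obtain c where c: "\<And>i. i \<notin> I \<Longrightarrow> c i = 0" "\<exists>i\<in>I. c i \<noteq> 0"
        "\<And>x. x \<in> P \<Longrightarrow> (\<Sum>i\<in>I. c i * p i x) = 0"
      using homogeneous_solution[of P I "\<lambda>x i. p i x"] PL(2) assms(1) by auto
    have "(\<Sum>i\<in>I. c i * p i x) = 0" if xL: "x \<in> L" for x
    proof (cases "x \<in> P")
      case False
      have "card (insert x P) > card P"
        using PL False by simp
      then have "\<not> inj (insert x P)"
        using P(2) by fastforce
      then obtain w where w: "zero (L - insert x P) w" "ker w" "\<not> zero L w"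
        using xL PL unfolding inj_def by blast
      have "w x \<noteq> 0"
      proof
        assume "w x = 0"
        then have "zero (L - P) w"
          using w(1) by (auto simp: zero_def)
        then show False
          using P(1) w(2,3) unfolding inj_def by blast
      qed
      have "0 = (\<Sum>i\<in>I. c i * (\<Sum>z\<in>L. w z * p i z))"
        using w(2) by (simp add: ker_def)
      also have "\<dots> = (\<Sum>z\<in>L. w z * (\<Sum>i\<in>I. c i * p i z))"
        by (simp only: sum_distrib_left, subst sum.swap) (simp add: mult_ac)
      also have "\<dots> = (\<Sum>z\<in>{x}. w z * (\<Sum>i\<in>I. c i * p i z))"
        using that w(1) c(3) assms(2) by (intro sum.mono_neutral_right) (auto simp: zero_def)
      finally show ?thesis
        using \<open>w x \<noteq> 0\<close> by simp
    qed (use c in simp)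
    then show False
      using indep c(2) unfolding independent_rows_def by blast
  qed
  then show ?thesis
    using P(1) unfolding inj_def ker_def zero_def by blast
qed

lemma independent_rows_square_kernel:
  fixes p :: "'i \<Rightarrow> 'x \<Rightarrow> 'a::{field,finite}"
  assumes "finite I" "finite L" "independent_rows I L p" "card L \<le> card I"
    and "\<And>i. i \<in> I \<Longrightarrow> (\<Sum>x\<in>L. w x * p i x) = 0" "x \<in> L"
  shows "w x = 0"
proof -
  obtain P where P: "P \<subseteq> L" "card I \<le> card P"
    "\<forall>w. (\<forall>x\<in>L - P. w x = 0) \<longrightarrow> (\<forall>i\<in>I. (\<Sum>x\<in>L. w x * p i x) = 0) \<longrightarrow> (\<forall>x\<in>L. w x = 0)"
    using independent_rows_pivots[OF assms(1-3)] by blast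
  have "P = L"
    using P(1,2) assms(2,4) by (intro card_subset_eq) (auto dest: card_mono)
  then show ?thesis
    using P(3)[rule_format, of w x] assms(5,6) by simp
qed

text \<open>Two points of a fibre differ by a kernel vector, hence are equal once they agree off the
  pivots. The product form avoids division and a truncated difference of exponents.\<close>

lemma independent_rows_fiber_card:
  fixes p :: "'i \<Rightarrow> 'x \<Rightarrow> 'a::{field,finite}"
  assumes "finite I" "finite L" "independent_rows I L p" and B: "B \<subseteq> PiE L (\<lambda>_. vecs n)"
    and eq: "\<And>a a' i t. a \<in> B \<Longrightarrow> a' \<in> B \<Longrightarrow> i \<in> I \<Longrightarrow>
      (\<Sum>x\<in>L. a x t * p i x) = (\<Sum>x\<in>L. a' x t * p i x)"
  shows "card B * (card (UNIV :: 'a set) ^ n) ^ card I \<le> (card (UNIV :: 'a set) ^ n) ^ card L"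
proof -
  obtain P where P: "P \<subseteq> L" "card I \<le> card P"
    "\<forall>w. (\<forall>x\<in>L - P. w x = 0) \<longrightarrow> (\<forall>i\<in>I. (\<Sum>x\<in>L. w x * p i x) = 0) \<longrightarrow> (\<forall>x\<in>L. w x = 0)"
    using independent_rows_pivots[OF assms(1-3)] by blast
  let ?r = "\<lambda>a. restrict a (L - P)"
  have finP: "finite P"
    using P assms(2) finite_subset by blast
  have "inj_on ?r B"
  proof (rule inj_onI)
    fix a a' assume a: "a \<in> B" "a' \<in> B" "?r a = ?r a'"
    have "a x t - a' x t = 0" if "x \<in> L" for x t
    proof (rule P(3)[rule_format, of "\<lambda>x. a x t - a' x t", OF _ _ that])
      fix z assume "z \<in> L - P"
      then show "a z t - a' z t = 0"
        using fun_cong[OF a(3), of z] by simp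
    next
      fix i assume "i \<in> I"
      then show "(\<Sum>x\<in>L. (a x t - a' x t) * p i x) = 0"
        using eq[OF a(1,2)] by (simp add: left_diff_distrib sum_subtractf)
    qed
    then show "a = a'"
      using a(1,2) B by (intro PiE_ext[of a L "\<lambda>_. vecs n" a']) auto
  qed
  then have "card B = card (?r ` B)"
    by (simp add: card_image)
  also have "\<dots> \<le> card (PiE (L - P) (\<lambda>_. vecs n :: (nat \<Rightarrow> 'a) set))"
  proof (rule card_mono)
    show "finite (PiE (L - P) (\<lambda>_. vecs n :: (nat \<Rightarrow> 'a) set))"
      using assms(2) by (intro finite_PiE) (auto simp: finite_vecs)
    show "?r ` B \<subseteq> PiE (L - P) (\<lambda>_. vecs n)"
      using B by (intro image_subsetI) (auto simp: restrict_PiE_iff)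
  qed
  also have "\<dots> = (card (UNIV :: 'a set) ^ n) ^ card (L - P)"
    using assms(2) by (simp add: card_PiE card_vecs)
  finally have "card B * (card (UNIV :: 'a set) ^ n) ^ card I \<le>
      (card (UNIV :: 'a set) ^ n) ^ card (L - P) * (card (UNIV :: 'a set) ^ n) ^ card I"
    by (rule mult_le_mono1)
  also have "\<dots> \<le> (card (UNIV :: 'a set) ^ n) ^ card (L - P) * (card (UNIV :: 'a set) ^ n) ^ card P"
    using P(2) card_field_ge_2[where 'a = 'a] by (intro mult_le_mono2 power_increasing) auto
  also have "\<dots> = (card (UNIV :: 'a set) ^ n) ^ card L"
    using P(1) assms(2) finP card_mono[OF assms(2) P(1)]
    by (simp add: card_Diff_subset flip: power_add)
  finally show ?thesis .
qed

section \<open>Adding a row outside the span\<close>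

definition in_span_rows :: "'i set \<Rightarrow> 'x set \<Rightarrow> ('i \<Rightarrow> 'x \<Rightarrow> 'a::field) \<Rightarrow> ('x \<Rightarrow> 'a) \<Rightarrow> bool" where
  "in_span_rows I L p b \<longleftrightarrow> (\<exists>c. \<forall>x\<in>L. b x = (\<Sum>i\<in>I. c i * p i x))"

text \<open>The new row is indexed by \<open>None\<close>. A relation with nonzero coefficient there
  could be solved for \<open>b\<close>, against the choice of \<open>b\<close> outside the
  span.\<close>

lemma independent_rows_insert:
  fixes p :: "'i \<Rightarrow> 'x \<Rightarrow> 'a::field"
  assumes "finite I" "independent_rows I L p" "\<not> in_span_rows I L p b"
  shows "independent_rows (insert None (Some ` I)) L (case_option b p)"
  unfolding independent_rows_def
proof (intro allI impI)
  fix c :: "'i option \<Rightarrow> 'a"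
  assume c: "\<forall>x\<in>L. (\<Sum>i\<in>insert None (Some ` I). c i * case_option b p i x) = 0"
  have sum: "c None * b x + (\<Sum>i\<in>I. c (Some i) * p i x) = 0" if "x \<in> L" for x
    using c that assms(1) by (simp add: sum.reindex)
  have "c None = 0"
  proof (rule ccontr)
    assume nz: "c None \<noteq> 0"
    have "b x = (\<Sum>i\<in>I. - c (Some i) / c None * p i x)" if "x \<in> L" for x
    proof -
      have "c None * b x = - (\<Sum>i\<in>I. c (Some i) * p i x)"
        using sum[OF that] by (simp add: eq_neg_iff_add_eq_0)
      then have "b x = - (\<Sum>i\<in>I. c (Some i) * p i x) / c None"
        using nz by (simp add: field_simps)
      then show ?thesis
        by (simp add: sum_divide_distrib sum_negf)
    qed
    then have "in_span_rows I L p b"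
      unfolding in_span_rows_def by (intro exI[of _ "\<lambda>i. - c (Some i) / c None"]) simp
    then show False
      using assms(3) by simp
  qed
  then have "\<forall>x\<in>L. (\<Sum>i\<in>I. c (Some i) * p i x) = 0"
    using sum by simp
  then have "\<forall>i\<in>I. c (Some i) = 0"
    using assms(2) unfolding independent_rows_def by (elim allE[of _ "\<lambda>i. c (Some i)"]) simp
  then show "\<forall>i\<in>insert None (Some ` I). c i = 0"
    using \<open>c None = 0\<close> by simp
qed

lemma card_option_index: "finite I \<Longrightarrow> card (insert None (Some ` I)) = Suc (card I)"
  by (simp add: card_insert_if image_iff card_image)

text \<open>One further condition outside the span lowers the bound by a factor q^n. This makes both
  the non-generic solutions and the blocked representations negligible.\<close>

lemma independent_rows_fiber_card_insert:
  fixes p :: "'i \<Rightarrow> 'x \<Rightarrow> 'a::{field,finite}"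
  assumes "finite I" "finite L" "independent_rows I L p" "\<not> in_span_rows I L p b"
    and "B \<subseteq> PiE L (\<lambda>_. vecs n)"
    and "\<And>a a' i t. a \<in> B \<Longrightarrow> a' \<in> B \<Longrightarrow> i \<in> I \<Longrightarrow>
      (\<Sum>x\<in>L. a x t * p i x) = (\<Sum>x\<in>L. a' x t * p i x)"
    and "\<And>a a' t. a \<in> B \<Longrightarrow> a' \<in> B \<Longrightarrow> (\<Sum>x\<in>L. a x t * b x) = (\<Sum>x\<in>L. a' x t * b x)"
  shows "card B * (card (UNIV :: 'a set) ^ n) ^ Suc (card I) \<le> (card (UNIV :: 'a set) ^ n) ^ card L"
proof -
  have "card B * (card (UNIV :: 'a set) ^ n) ^ card (insert None (Some ` I)) \<le> (card (UNIV :: 'a set) ^ n) ^ card L"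
  proof (rule independent_rows_fiber_card[OF _ assms(2) independent_rows_insert[OF assms(1,3,4)] assms(5)])
    fix a a' t and i :: "'i option"
    assume "a \<in> B" "a' \<in> B" "i \<in> insert None (Some ` I)"
    then show "(\<Sum>x\<in>L. a x t * case_option b p i x) = (\<Sum>x\<in>L. a' x t * case_option b p i x)"
      using assms(6)[of a a' _ t] assms(7)[of a a' t] by (cases i) (simp_all add: image_iff)
  qed (use assms(1) in simp)
  then show ?thesis
    using assms(1) by (simp only: card_option_index)
qed

section \<open>Gluing the classes\<close>

text \<open>\<open>Y\<close> plays the role of the span of all y_C. A relation restricted to the
  newest class is proportional to \<kappa> and contributes a multiple of its y_C; closure of
  \<open>Y\<close> under subtracting such multiples keeps the remaining relation in
  \<open>Y\<close>, so the induction hypothesis applies to it.\<close>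

lemma generically_representable_glue:
  fixes \<kappa> :: "nat \<Rightarrow> 'a::{field,finite}" and y :: "nat set \<Rightarrow> nat \<Rightarrow> 'a"
  assumes "finite \<C>" "\<And>C. C \<in> \<C> \<Longrightarrow> finite C"
    and disj: "\<And>C C'. C \<in> \<C> \<Longrightarrow> C' \<in> \<C> \<Longrightarrow> C \<noteq> C' \<Longrightarrow> C \<inter> C' = {}"
    and Y: "finite Y" "\<And>C v r. C \<in> \<C> \<Longrightarrow> v \<in> Y \<Longrightarrow> (\<lambda>t. v t - r * y C t) \<in> Y"
    and Q: "card Y * card (UNIV :: 'a set) ^ card (\<Union>\<C>) \<le> Q"
    and rep: "\<And>C. C \<in> \<C> \<Longrightarrow> generically_representable S Q C \<kappa> (y C)"
  shows "\<exists>x. (\<forall>j\<in>\<Union>\<C>. x j \<in> S) \<and> (\<forall>C\<in>\<C>. lin_comb C \<kappa> x = y C) \<and>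
    (\<forall>b. lin_comb (\<Union>\<C>) b x \<in> Y \<longrightarrow> (\<forall>C\<in>\<C>. \<exists>r. \<forall>j\<in>C. b j = r * \<kappa> j))"
  using assms
proof (induction \<C> rule: finite_induct)
  case (insert C \<D>)
  define U where "U = \<Union>\<D>"
  have finU: "finite U" "finite C"
    using insert.hyps(1) insert.prems(1) by (auto simp: U_def)
  have CU: "C \<inter> U = {}"
    using insert.prems(2) insert.hyps(2) by (fastforce simp: U_def)
  have q: "card (UNIV :: 'a set) \<ge> 1"
    using card_field_ge_2[where 'a = 'a] by linarith
  have "card U \<le> card (\<Union> (insert C \<D>))"
    using finU by (intro card_mono) (auto simp: U_def)
  then have "card (UNIV :: 'a set) ^ card U \<le> card (UNIV :: 'a set) ^ card (\<Union> (insert C \<D>))"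
    using q by (intro power_increasing) auto
  then have QU: "card Y * card (UNIV :: 'a set) ^ card U \<le> Q"
    using insert.prems(5) by (meson le_trans mult_le_mono2)
  have "\<exists>x. (\<forall>j\<in>\<Union>\<D>. x j \<in> S) \<and> (\<forall>C\<in>\<D>. lin_comb C \<kappa> x = y C) \<and>
    (\<forall>b. lin_comb (\<Union>\<D>) b x \<in> Y \<longrightarrow> (\<forall>C\<in>\<D>. \<exists>r. \<forall>j\<in>C. b j = r * \<kappa> j))"
    by (rule insert.IH) (use insert.prems QU in \<open>auto simp: U_def\<close>)
  then obtain x where x: "\<forall>j\<in>U. x j \<in> S" "\<forall>C\<in>\<D>. lin_comb C \<kappa> x = y C"
      "\<And>b. lin_comb U b x \<in> Y \<Longrightarrow> \<forall>C\<in>\<D>. \<exists>r. \<forall>j\<in>C. b j = r * \<kappa> j"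
    unfolding U_def by blast
  \<comment> \<open>The new class must be generic modulo \<open>Y\<close> and the span of all points
    chosen before; \<open>Q\<close> is large enough for every stage at once.\<close>
  define W where "W = (\<lambda>(v, b) t. v t - lin_comb U b x t) ` (Y \<times> PiE U (\<lambda>_. UNIV))"
  have fin: "finite (Y \<times> PiE U (\<lambda>_. UNIV :: 'a set))"
    using insert.prems(3) finU by (intro finite_cartesian_product finite_PiE) auto
  have "card W \<le> card (Y \<times> PiE U (\<lambda>_. UNIV :: 'a set))"
    unfolding W_def using fin by (rule card_image_le)
  also have "\<dots> \<le> Q"
    using QU finU by (simp add: card_cartesian_product card_PiE)
  finally have "finite W \<and> card W \<le> Q"
    using fin by (simp add: W_def)
  then obtain x' where x': "generic_representation S W C \<kappa> (y C) x'"
    using insert.prems(6) unfolding generically_representable_def by blast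
  define z where "z = (\<lambda>j. if j \<in> C then x' j else x j)"
  have lcC: "lin_comb C b z = lin_comb C b x'" for b
    unfolding lin_comb_def by (intro ext sum.cong) (auto simp: z_def)
  have lcV: "lin_comb V b z = lin_comb V b x" if "V \<subseteq> U" for V b
    unfolding lin_comb_def using that CU by (intro ext sum.cong) (auto simp: z_def)
  have lc: "lin_comb (\<Union> (insert C \<D>)) b z t = lin_comb C b x' t + lin_comb U b x t" for b t
  proof -
    have "lin_comb (\<Union> (insert C \<D>)) b z t = lin_comb (C \<union> U) b z t"
      by (simp add: U_def)
    also have "\<dots> = lin_comb C b z t + lin_comb U b z t"
      unfolding lin_comb_def using finU CU by (simp add: sum.union_disjoint)
    finally show ?thesis
      by (simp add: lcC lcV)
  qed
  show ?case
  proof (intro exI[of _ z] conjI allI impI)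
    show "\<forall>j\<in>\<Union> (insert C \<D>). z j \<in> S"
      using x(1) x' by (auto simp: z_def U_def generic_representation_def)
    show "\<forall>C'\<in>insert C \<D>. lin_comb C' \<kappa> z = y C'"
    proof
      fix C' assume "C' \<in> insert C \<D>"
      then consider "C' = C" | "C' \<in> \<D>" by blast
      then show "lin_comb C' \<kappa> z = y C'"
      proof cases
        case 1
        then show ?thesis
          using x' lcC by (simp add: generic_representation_def)
      next
        case 2
        then have "C' \<subseteq> U"
          by (auto simp: U_def)
        then show ?thesis
          using x(2) 2 lcV by simp
      qed
    qed
    fix b assume b: "lin_comb (\<Union> (insert C \<D>)) b z \<in> Y"
    have "lin_comb U (restrict b U) x = lin_comb U b x"
      unfolding lin_comb_def by (intro ext sum.cong) auto
    then have "lin_comb C b x' = (\<lambda>t. lin_comb (\<Union> (insert C \<D>)) b z t - lin_comb U (restrict b U) x t)"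
      by (intro ext) (simp only: lc, simp)
    then have "lin_comb C b x' \<in> W"
      unfolding W_def using b
      by (intro image_eqI[of _ _ "(lin_comb (\<Union> (insert C \<D>)) b z, restrict b U)"]) auto
    then obtain r where r: "\<forall>j\<in>C. b j = r * \<kappa> j"
      using x' unfolding generic_representation_def by blast
    have "lin_comb C b x' t = r * y C t" for t
    proof -
      have "lin_comb C b x' t = r * lin_comb C \<kappa> x' t"
        unfolding lin_comb_def sum_distrib_left using r by (intro sum.cong) (auto simp: mult.assoc)
      then show ?thesis
        using x' by (simp add: generic_representation_def)
    qed
    then have "lin_comb U b x = (\<lambda>t. lin_comb (\<Union> (insert C \<D>)) b z t - r * y C t)"
      by (intro ext) (simp only: lc, simp)
    then have "lin_comb U b x \<in> Y"
      using insert.prems(4)[of C _ r] b by simp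
    then show "\<forall>C'\<in>insert C \<D>. \<exists>r. \<forall>j\<in>C'. b j = r * \<kappa> j"
      using x(3) r by blast
  qed
qed simp

text \<open>Pigeonhole on the pairs of points of \<open>S ^ L\<close> in a common fibre of the system: some generic
  solution \<open>z\<close> occurs so often as a difference that, coordinatewise, few points cannot block it.\<close>

lemma generic_popular_difference:
  fixes p :: "'i \<Rightarrow> 'x \<Rightarrow> 'a::{field,finite}" and S :: "(nat \<Rightarrow> 'a) set"
  defines "q \<equiv> card (UNIV :: 'a set)"
  assumes I: "finite I" and L: "finite L" and indep: "independent_rows I L p"
    and S: "S \<subseteq> vecs n" "h < card S"
    and big: "(h + q ^ card L) * (q ^ n) ^ (2 * card L) < card S ^ (2 * card L) * q ^ n"
  shows "\<exists>z. (\<forall>i\<in>I. \<forall>t. (\<Sum>x\<in>L. z x t * p i x) = 0) \<and>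
    (\<forall>b. (\<forall>t. (\<Sum>x\<in>L. z x t * b x) = 0) \<longrightarrow> in_span_rows I L p b) \<and>
    (\<forall>x\<in>L. \<forall>H. finite H \<and> card H \<le> h \<longrightarrow> (\<exists>a\<in>S - H. (\<lambda>t. a t - z x t) \<in> S))"
proof -
  define N where "N = q ^ n"
  have cN: "card (vecs n :: (nat \<Rightarrow> 'a) set) = N"
    unfolding N_def q_def by (rule card_vecs)
  have N: "N \<ge> 1"
    using card_field_ge_2[where 'a = 'a] by (simp add: N_def q_def)
  have finS: "finite S"
    using S finite_vecs finite_subset by blast
  define V where "V = PiE L (\<lambda>_. vecs n :: (nat \<Rightarrow> 'a) set)"
  have finV: "finite V"
    unfolding V_def using L by (intro finite_PiE) (auto simp: finite_vecs)
  define \<phi> where "\<phi> = (\<lambda>(a :: 'x \<Rightarrow> nat \<Rightarrow> 'a). restrict (\<lambda>i t. \<Sum>x\<in>L. a x t * p i x) I)"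
  define K where "K = {z\<in>V. \<forall>i\<in>I. \<forall>t. (\<Sum>x\<in>L. z x t * p i x) = 0}"
  define G where "G = {z\<in>K. \<forall>b. (\<forall>t. (\<Sum>x\<in>L. z x t * b x) = 0) \<longrightarrow> in_span_rows I L p b}"
  have finK: "finite K" "G \<subseteq> K" "K \<subseteq> V"
    using finV by (auto simp: K_def G_def)
  have cK: "card K * N ^ card I \<le> N ^ card L"
    unfolding N_def q_def
    by (rule independent_rows_fiber_card[OF I L indep]) (auto simp: K_def V_def)
  \<comment> \<open>\<open>A\<close> is a most popular fibre of the system on S^L, so that all
    differences of its elements solve the system.\<close>
  obtain A where A: "A \<subseteq> PiE L (\<lambda>_. S)" "card S ^ card L \<le> card A * N ^ card I"
      "\<And>a a' i t. a \<in> A \<Longrightarrow> a' \<in> A \<Longrightarrow> i \<in> I \<Longrightarrow>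
        (\<Sum>x\<in>L. a x t * p i x) = (\<Sum>x\<in>L. a' x t * p i x)"
  proof -
    let ?P = "PiE L (\<lambda>_. S)" and ?T = "PiE I (\<lambda>_. vecs n :: (nat \<Rightarrow> 'a) set)"
    have fin: "finite ?P" "finite ?T"
      using L I finS by (simp_all add: finite_PiE finite_vecs)
    have \<phi>: "\<phi> \<in> ?P \<rightarrow> ?T"
    proof
      fix a assume a: "a \<in> ?P"
      have "a x t = 0" if "x \<in> L" "n \<le> t" for x t
        using PiE_mem[OF a that(1)] S(1) that(2) by (auto simp: vecs_def)
      then show "\<phi> a \<in> ?T"
        unfolding \<phi>_def by (simp add: restrict_PiE_iff vecs_def)
    qed
    have "(\<lambda>_. 0) \<in> (vecs n :: (nat \<Rightarrow> 'a) set)"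
      by (simp add: vecs_def)
    then have "?T \<noteq> {}"
      by (subst PiE_eq_empty_iff) blast
    then obtain v where v: "card ?P \<le> card (\<phi> -` {v} \<inter> ?P) * card ?T"
      using pigeonhole_card[OF \<phi> fin] by blast
    show thesis
    proof (rule that[of "\<phi> -` {v} \<inter> ?P"])
      show "card S ^ card L \<le> card (\<phi> -` {v} \<inter> ?P) * N ^ card I"
        using v L I by (simp add: card_PiE cN)
      fix a a' i t assume "a \<in> \<phi> -` {v} \<inter> ?P" "a' \<in> \<phi> -` {v} \<inter> ?P" and i: "i \<in> I"
      then have "\<phi> a i t = \<phi> a' i t"
        by simp
      then show "(\<Sum>x\<in>L. a x t * p i x) = (\<Sum>x\<in>L. a' x t * p i x)"
        using i by (simp add: \<phi>_def)
    qed simp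
  qed
  have AV: "A \<subseteq> V"
    using A(1) S(1) unfolding V_def by (meson PiE_mono order_trans)
  have finA: "finite A"
    using AV finV finite_subset by blast
  have cA: "card A * N ^ card I \<le> N ^ card L"
    unfolding N_def q_def
    by (rule independent_rows_fiber_card[OF I L indep AV[unfolded V_def]]) (rule A(3))
  define diff where "diff = (\<lambda>(a :: 'x \<Rightarrow> nat \<Rightarrow> 'a, a'). restrict (\<lambda>x t. a x t - a' x t) L)"
  have diff: "diff ` (A \<times> A) \<subseteq> K"
  proof (rule image_subsetI)
    fix d assume "d \<in> A \<times> A"
    then obtain a a' where d: "d = (a, a')" "a \<in> A" "a' \<in> A"
      by blast
    have "diff d \<in> V"
    proof -
      have "(\<lambda>t. a x t - a' x t) \<in> vecs n" if "x \<in> L" for x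
        using PiE_mem[of a L "\<lambda>_. vecs n" x] PiE_mem[of a' L "\<lambda>_. vecs n" x] AV d that
        by (auto simp: vecs_def V_def subset_iff)
      then show ?thesis
        unfolding diff_def V_def d by (simp add: restrict_PiE_iff)
    qed
    moreover have "(\<Sum>x\<in>L. diff d x t * p i x) = 0" if "i \<in> I" for i t
      using A(3)[OF d(2,3) that, of t] by (simp add: diff_def d(1) left_diff_distrib sum_subtractf)
    ultimately show "diff d \<in> K"
      by (simp add: K_def)
  qed
  define F where "F = (\<lambda>z. {d \<in> A \<times> A. diff d = z})"
  have Ffst: "inj_on fst (F z)" "finite (F z)" for z
  proof -
    show "inj_on fst (F z)"
    proof (rule inj_onI, clarify)
      fix a a' b b' assume *: "(a, a') \<in> F z" "(b, b') \<in> F z" "fst (a, a') = fst (b, b')"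
      then have eq: "a = b" "diff (a, a') = diff (b, b')"
        by (simp_all add: F_def)
      have "a' x = b' x" if "x \<in> L" for x
      proof
        fix t
        show "a' x t = b' x t"
          using fun_cong[OF fun_cong[OF eq(2), of x], of t] eq(1) that by (simp add: diff_def)
      qed
      moreover have "a' \<in> V" "b' \<in> V"
        using * AV by (auto simp: F_def)
      ultimately have "a' = b'"
        unfolding V_def by (intro PiE_ext[of a' L "\<lambda>_. vecs n" b']) auto
      then show "a = b \<and> a' = b'"
        using eq(1) by simp
    qed
    show "finite (F z)"
      using finA by (simp add: F_def)
  qed
  \<comment> \<open>A pair with given difference is determined by its first component.\<close>
  have cF: "card (F z) \<le> card A" for z
  proof -
    have "card (F z) = card (fst ` F z)"
      using Ffst by (simp add: card_image)
    also have "\<dots> \<le> card A"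
      using finA by (intro card_mono) (auto simp: F_def)
    finally show ?thesis .
  qed
  have cAA: "card A * card A = (\<Sum>z\<in>K. card (F z))"
  proof -
    have "(\<Sum>z\<in>K. card (F z)) = (\<Sum>z\<in>K. \<Sum>d\<in>{d \<in> A \<times> A. diff d = z}. 1)"
      by (simp add: F_def)
    also have "\<dots> = (\<Sum>d\<in>A \<times> A. 1)"
      using finA finK diff by (intro sum.group) auto
    finally show ?thesis
      by (simp add: card_cartesian_product)
  qed
  \<comment> \<open>A non-generic solution satisfies one of at most q^card L conditions outside the
    row span, and each of them costs a factor N.\<close>
  have cNG: "card (K - G) * N ^ Suc (card I) \<le> q ^ card L * N ^ card L"
  proof -
    define B where "B = {b \<in> PiE L (\<lambda>_. UNIV :: 'a set). \<not> in_span_rows I L p b}"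
    define Kb where "Kb = (\<lambda>b. {z\<in>K. \<forall>t. (\<Sum>x\<in>L. z x t * b x) = 0})"
    have finPB: "finite (PiE L (\<lambda>_. UNIV :: 'a set))"
      using L by (simp add: finite_PiE)
    then have finB: "finite B"
      by (simp add: B_def)
    have cB: "card B \<le> q ^ card L"
      using card_mono[OF finPB, of B] L by (simp add: B_def card_PiE q_def)
    have "K - G \<subseteq> (\<Union>b\<in>B. Kb b)"
    proof
      fix z assume z: "z \<in> K - G"
      then obtain b where b: "\<forall>t. (\<Sum>x\<in>L. z x t * b x) = 0" "\<not> in_span_rows I L p b"
        by (auto simp: G_def)
      have "restrict b L \<in> B" "z \<in> Kb (restrict b L)"
        using b z by (auto simp: B_def Kb_def in_span_rows_def)
      then show "z \<in> (\<Union>b\<in>B. Kb b)"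
        by blast
    qed
    then have "card (K - G) \<le> card (\<Union>b\<in>B. Kb b)"
      using finB finK by (intro card_mono) (auto simp: Kb_def)
    also have "\<dots> \<le> (\<Sum>b\<in>B. card (Kb b))"
      by (rule card_UN_le[OF finB])
    finally have "card (K - G) * N ^ Suc (card I) \<le> (\<Sum>b\<in>B. card (Kb b)) * N ^ Suc (card I)"
      by (rule mult_le_mono1)
    also have "\<dots> = (\<Sum>b\<in>B. card (Kb b) * N ^ Suc (card I))"
      by (rule sum_distrib_right)
    also have "\<dots> \<le> (\<Sum>b\<in>B. N ^ card L)"
    proof (rule sum_mono)
      fix b assume "b \<in> B"
      then have b: "\<not> in_span_rows I L p b"
        by (simp add: B_def)
      show "card (Kb b) * N ^ Suc (card I) \<le> N ^ card L"
        unfolding N_def q_def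
        by (rule independent_rows_fiber_card_insert[OF I L indep b]) (auto simp: Kb_def K_def V_def)
    qed
    also have "\<dots> \<le> q ^ card L * N ^ card L"
      using cB by simp
    finally show ?thesis .
  qed
  show ?thesis
  proof (rule ccontr)
    assume no: "\<not> ?thesis"
    \<comment> \<open>If a generic z is unpopular at a coordinate x, then the first component of
      every pair with difference z takes a value in the small set \<open>H\<close> at x. Fixing that
      value is one more condition on \<open>A\<close>, so z has few pairs.\<close>
    have cG: "card (F z) * N ^ Suc (card I) \<le> h * N ^ card L" if z: "z \<in> G" for z
    proof -
      have z1: "\<forall>i\<in>I. \<forall>t. (\<Sum>x\<in>L. z x t * p i x) = 0"
        and z2: "\<forall>b. (\<forall>t. (\<Sum>x\<in>L. z x t * b x) = 0) \<longrightarrow> in_span_rows I L p b"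
        using z by (auto simp: G_def K_def)
      from no have "\<not> (\<forall>x\<in>L. \<forall>H. finite H \<and> card H \<le> h \<longrightarrow> (\<exists>a\<in>S - H. (\<lambda>t. a t - z x t) \<in> S))"
        using z1 z2 by blast
      then obtain x H where x: "x \<in> L" and H: "finite H" "card H \<le> h"
        and none: "\<And>a. a \<in> S - H \<Longrightarrow> (\<lambda>t. a t - z x t) \<notin> S"
        by blast
      define e where "e = (\<lambda>x'. if x' = x then 1 else 0 :: 'a)"
      have e: "(\<Sum>x'\<in>L. a x' t * e x') = a x t" for a :: "'x \<Rightarrow> nat \<Rightarrow> 'a" and t
        using L x by (simp add: e_def if_distrib[of "\<lambda>c. _ * c"] sum.delta cong: if_cong)
      \<comment> \<open>If the coordinate functional at x were in the row span, z would vanish at x.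
        Then every a in \<open>S - H\<close> would satisfy a - 0 in \<open>S\<close>, leaving
        \<open>S\<close> inside \<open>H\<close>, which is too small.\<close>
      have e_span: "\<not> in_span_rows I L p e"
      proof
        assume "in_span_rows I L p e"
        then obtain c where c: "\<forall>x'\<in>L. e x' = (\<Sum>i\<in>I. c i * p i x')"
          unfolding in_span_rows_def by blast
        have "z x t = 0" for t
        proof -
          have "z x t = (\<Sum>x'\<in>L. z x' t * (\<Sum>i\<in>I. c i * p i x'))"
            unfolding e[symmetric] using c by (intro sum.cong) auto
          also have "\<dots> = (\<Sum>i\<in>I. c i * (\<Sum>x'\<in>L. z x' t * p i x'))"
            by (simp only: sum_distrib_left, subst sum.swap) (simp add: mult_ac)
          finally show ?thesis
            using z1 by simp
        qed
        then have "S \<subseteq> H"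
          using none by fastforce
        then show False
          using H S(2) card_mono[of H S] by linarith
      qed
      define Ah where "Ah = (\<lambda>w. {a\<in>A. a x = w})"
      have "fst ` F z \<subseteq> (\<Union>w\<in>H. Ah w)"
      proof (rule image_subsetI)
        fix d assume "d \<in> F z"
        then obtain a a' where d: "d = (a, a')" "a \<in> A" "a' \<in> A" "diff (a, a') = z"
          by (auto simp: F_def)
        have "(\<lambda>t. a x t - z x t) = a' x"
          using x by (simp add: diff_def flip: d(4))
        moreover have "a x \<in> S" "a' x \<in> S"
          using A(1) d x by auto
        ultimately have "a x \<in> H"
          using none[of "a x"] by auto
        then show "fst d \<in> (\<Union>w\<in>H. Ah w)"
          using d by (simp add: Ah_def)
      qed
      then have "card (fst ` F z) \<le> card (\<Union>w\<in>H. Ah w)"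
        using H finA by (intro card_mono) (auto simp: Ah_def)
      also have "\<dots> \<le> (\<Sum>w\<in>H. card (Ah w))"
        by (rule card_UN_le[OF H(1)])
      finally have "card (F z) * N ^ Suc (card I) \<le> (\<Sum>w\<in>H. card (Ah w)) * N ^ Suc (card I)"
        using Ffst by (intro mult_le_mono1) (simp add: card_image)
      also have "\<dots> = (\<Sum>w\<in>H. card (Ah w) * N ^ Suc (card I))"
        by (rule sum_distrib_right)
      also have "\<dots> \<le> (\<Sum>w\<in>H. N ^ card L)"
      proof (rule sum_mono)
        fix w
        have AhV: "Ah w \<subseteq> PiE L (\<lambda>_. vecs n)"
          using AV by (auto simp: Ah_def V_def)
        show "card (Ah w) * N ^ Suc (card I) \<le> N ^ card L"
          unfolding N_def q_def
          by (rule independent_rows_fiber_card_insert[OF I L indep e_span AhV])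
            (auto simp: Ah_def e intro: A(3))
      qed
      also have "\<dots> \<le> h * N ^ card L"
        using H by simp
      finally show ?thesis .
    qed
    \<comment> \<open>The pairs in \<open>A\<close> are counted by their difference: generic
      differences account for the term with \<open>h\<close>, non-generic ones for the term with
      q^card L. The total contradicts \<open>big\<close>.\<close>
    have "card A * card A * (N ^ card I * N ^ Suc (card I)) =
        (\<Sum>z\<in>G. card (F z) * (N ^ card I * N ^ Suc (card I))) +
        (\<Sum>z\<in>K - G. card (F z) * (N ^ card I * N ^ Suc (card I)))"
      unfolding cAA sum_distrib_right using finK by (subst sum.subset_diff[of G K]) (auto simp: add.commute)
    also have "(\<Sum>z\<in>G. card (F z) * (N ^ card I * N ^ Suc (card I))) \<le> (\<Sum>z\<in>G. h * N ^ card L * N ^ card I)"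
    proof (rule sum_mono)
      fix z assume "z \<in> G"
      from mult_le_mono1[OF cG[OF this], of "N ^ card I"]
      show "card (F z) * (N ^ card I * N ^ Suc (card I)) \<le> h * N ^ card L * N ^ card I"
        by (simp only: mult_ac)
    qed
    also have "\<dots> \<le> h * N ^ card L * N ^ card L"
    proof -
      have "card G \<le> card K"
        using finK by (intro card_mono) auto
      then have "card G * N ^ card I \<le> N ^ card L"
        using cK by (meson le_trans mult_le_mono1)
      from mult_le_mono2[OF this, of "h * N ^ card L"] show ?thesis
        by (simp only: sum_constant mult_ac of_nat_id)
    qed
    also have "(\<Sum>z\<in>K - G. card (F z) * (N ^ card I * N ^ Suc (card I))) \<le>
        (\<Sum>z\<in>K - G. card A * (N ^ card I * N ^ Suc (card I)))"
      using cF by (intro sum_mono mult_le_mono1)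
    also have "\<dots> = (card (K - G) * N ^ Suc (card I)) * (card A * N ^ card I)"
      by (simp only: sum_constant mult_ac of_nat_id)
    also have "\<dots> \<le> (q ^ card L * N ^ card L) * N ^ card L"
      using cNG cA by (rule mult_le_mono)
    finally have "card A * card A * (N ^ card I * N ^ Suc (card I)) \<le>
        h * N ^ card L * N ^ card L + q ^ card L * N ^ card L * N ^ card L"
      by simp
    moreover have "card S ^ (2 * card L) * N \<le> card A * card A * (N ^ card I * N ^ Suc (card I))"
    proof -
      have "card S ^ (2 * card L) * N = (card S ^ card L * card S ^ card L) * N"
        by (simp add: mult_2 power_add)
      also have "\<dots> \<le> ((card A * N ^ card I) * (card A * N ^ card I)) * N"
        by (intro mult_le_mono1 mult_le_mono A(2))
      finally show ?thesis
        by (simp add: mult_ac)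
    qed
    moreover have "h * N ^ card L * N ^ card L + q ^ card L * N ^ card L * N ^ card L =
        (h + q ^ card L) * N ^ (2 * card L)"
      by (simp only: mult_2 power_add add_mult_distrib mult.assoc)
    ultimately show False
      using big unfolding N_def[symmetric] by linarith
  qed
qed

section \<open>Column classes\<close>

lemma generically_representable_scale:
  fixes \<kappa> :: "nat \<Rightarrow> 'a::field"
  assumes "s \<noteq> 0" "generically_representable S Q C (\<lambda>j. \<kappa> j / s) y"
  shows "generically_representable S Q C \<kappa> (\<lambda>t. s * y t)"
proof -
  have "generic_representation S W C \<kappa> (\<lambda>t. s * y t) x"
    if x: "generic_representation S W C (\<lambda>j. \<kappa> j / s) y x" for W x
    unfolding generic_representation_def
  proof (intro conjI allI impI)
    show "\<forall>j\<in>C. x j \<in> S"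
      using x by (simp add: generic_representation_def)
    have "lin_comb C \<kappa> x t = s * lin_comb C (\<lambda>j. \<kappa> j / s) x t" for t
      using assms(1) by (simp add: lin_comb_def sum_distrib_left)
    then show "lin_comb C \<kappa> x = (\<lambda>t. s * y t)"
      using x by (auto simp: generic_representation_def)
    fix b assume "lin_comb C b x \<in> W"
    then obtain r where "\<forall>j\<in>C. b j = r * (\<kappa> j / s)"
      using x unfolding generic_representation_def by blast
    then show "\<exists>r. \<forall>j\<in>C. b j = r * \<kappa> j"
      by (intro exI[of _ "r / s"]) simp
  qed
  then show ?thesis
    using assms(2) unfolding generically_representable_def by blast
qed

text \<open>Write y = a - (a - y), with a at the index \<open>\<rho>\<close> and a - y represented
  by the remaining indices. The budget \<open>Q * q\<close> pays for genericity modulo multiples of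
  a, and the points to be avoided by a are those of \<open>combos W y\<close>.\<close>

lemma generically_representable_sum_zero:
  fixes \<kappa> :: "nat \<Rightarrow> 'a::{field,finite}" and y :: "nat \<Rightarrow> 'a"
  defines "q \<equiv> card (UNIV :: 'a set)"
  assumes C: "finite C" "\<rho> \<in> C" and \<kappa>: "\<kappa> \<rho> = 1"
    and pop: "\<And>H. finite H \<Longrightarrow> card H \<le> Q * (q * q) \<Longrightarrow>
      \<exists>a\<in>S - H. generically_representable S (Q * q) (C - {\<rho>}) (\<lambda>j. - \<kappa> j) (\<lambda>t. a t - y t)"
  shows "generically_representable S Q C \<kappa> y"
  unfolding generically_representable_def
proof (intro allI impI)
  fix W :: "(nat \<Rightarrow> 'a) set"
  assume W: "finite W \<and> card W \<le> Q"
  obtain a where a: "a \<in> S" "a \<notin> combos W y"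
      "generically_representable S (Q * q) (C - {\<rho>}) (\<lambda>j. - \<kappa> j) (\<lambda>t. a t - y t)"
    using pop[of "combos W y"] W finite_combos[of W y] card_combos[of W Q y] by (auto simp: q_def)
  define W1 where "W1 = (\<lambda>(w, s) t. w t - s * a t) ` (W \<times> (UNIV :: 'a set))"
  have "card W1 \<le> card (W \<times> (UNIV :: 'a set))"
    unfolding W1_def using W by (intro card_image_le) simp
  also have "\<dots> \<le> Q * q"
    using W by (simp add: card_cartesian_product q_def)
  finally have "finite W1 \<and> card W1 \<le> Q * q"
    using W by (simp add: W1_def)
  then obtain x' where x': "generic_representation S W1 (C - {\<rho>}) (\<lambda>j. - \<kappa> j) (\<lambda>t. a t - y t) x'"
    using a(3) unfolding generically_representable_def by blast
  define z where "z = (\<lambda>j. if j = \<rho> then a else x' j)"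
  have lc: "lin_comb C b z t = b \<rho> * a t + lin_comb (C - {\<rho>}) b x' t" for b t
  proof -
    have "lin_comb C b z t = b \<rho> * z \<rho> t + (\<Sum>j\<in>C - {\<rho>}. b j * z j t)"
      unfolding lin_comb_def using C by (simp add: sum.remove)
    also have "(\<Sum>j\<in>C - {\<rho>}. b j * z j t) = lin_comb (C - {\<rho>}) b x' t"
      unfolding lin_comb_def by (intro sum.cong) (auto simp: z_def)
    finally show ?thesis
      by (simp add: z_def)
  qed
  have lc': "lin_comb (C - {\<rho>}) b x' t = r * (a t - y t)" if "\<forall>j\<in>C - {\<rho>}. b j = r * - \<kappa> j" for b r t
  proof -
    have "lin_comb (C - {\<rho>}) b x' t = (\<Sum>j\<in>C - {\<rho>}. r * (- \<kappa> j * x' j t))"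
      unfolding lin_comb_def using that by (intro sum.cong) (auto simp: mult.assoc)
    also have "\<dots> = r * lin_comb (C - {\<rho>}) (\<lambda>j. - \<kappa> j) x' t"
      by (simp only: lin_comb_def sum_distrib_left)
    also have "lin_comb (C - {\<rho>}) (\<lambda>j. - \<kappa> j) x' = (\<lambda>t. a t - y t)"
      using x' by (simp add: generic_representation_def)
    finally show ?thesis .
  qed
  show "\<exists>x. generic_representation S W C \<kappa> y x"
    unfolding generic_representation_def
  proof (intro exI[of _ z] conjI allI impI)
    show "\<forall>j\<in>C. z j \<in> S"
      using a(1) x' by (auto simp: z_def generic_representation_def)
    show "lin_comb C \<kappa> z = y"
    proof
      fix t
      show "lin_comb C \<kappa> z t = y t"
        using lc'[of \<kappa> "- 1" t] by (simp add: lc \<kappa>)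
    qed
    fix b assume b: "lin_comb C b z \<in> W"
    have "lin_comb (C - {\<rho>}) b x' = (\<lambda>t. lin_comb C b z t - b \<rho> * a t)"
      by (intro ext) (simp add: lc)
    then have "lin_comb (C - {\<rho>}) b x' \<in> W1"
      unfolding W1_def using b by (intro image_eqI[of _ _ "(lin_comb C b z, b \<rho>)"]) auto
    then obtain r where r: "\<forall>j\<in>C - {\<rho>}. b j = r * - \<kappa> j"
      using x' unfolding generic_representation_def by blast
    \<comment> \<open>Reduced to the two vectors a and y, the relation lies in \<open>W\<close>; as
      a is outside \<open>combos W y\<close>, its coefficient must vanish, which gives
      proportionality at \<open>\<rho>\<close> too.\<close>
    have "(\<lambda>t. (b \<rho> + r) * a t + (- r) * y t) = lin_comb C b z"
      by (intro ext) (simp add: lc lc'[OF r] algebra_simps)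
    then have "b \<rho> + r = 0"
      using combosI[of "b \<rho> + r" a "- r" y W] a(2) b by auto
    then have "b \<rho> = - r"
      by (simp add: eq_neg_iff_add_eq_0)
    then have "\<forall>j\<in>C. b j = - r * \<kappa> j"
      using r \<kappa> by auto
    then show "\<exists>r. \<forall>j\<in>C. b j = r * \<kappa> j"
      by blast
  qed
qed

section \<open>Column equivalence classes and the system with one column for each class\<close>

lemma col_equiv_refl: "col_equiv A m j j"
  unfolding col_equiv_def by (intro exI[of _ 1]) simp

lemma col_equiv_sym: "col_equiv A m j j' \<Longrightarrow> col_equiv A m j' j"
  unfolding col_equiv_def
proof (elim exE conjE)
  fix c assume "c \<noteq> 0" "\<forall>i<m. A i j = c * A i j'"
  then show "\<exists>c. c \<noteq> 0 \<and> (\<forall>i<m. A i j' = c * A i j)"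
    by (intro exI[of _ "1 / c"]) simp
qed

lemma col_equiv_trans: "col_equiv A m j j' \<Longrightarrow> col_equiv A m j' j'' \<Longrightarrow> col_equiv A m j j''"
  unfolding col_equiv_def
proof (elim exE conjE)
  fix c d assume "c \<noteq> 0" "\<forall>i<m. A i j = c * A i j'" "d \<noteq> 0" "\<forall>i<m. A i j' = d * A i j''"
  then show "\<exists>c. c \<noteq> 0 \<and> (\<forall>i<m. A i j = c * A i j'')"
    by (intro exI[of _ "c * d"]) (simp add: mult.assoc)
qed

lemma Union_col_classes: "\<Union> (col_classes A m k) = {..<k}"
proof
  show "\<Union> (col_classes A m k) \<subseteq> {..<k}"
    unfolding col_classes_def by blast
  show "{..<k} \<subseteq> \<Union> (col_classes A m k)"
  proof
    fix j assume "j \<in> {..<k}"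
    then show "j \<in> \<Union> (col_classes A m k)"
      unfolding col_classes_def by (intro UnionI[of "{j'. j' < k \<and> col_equiv A m j j'}"])
        (auto simp: col_equiv_refl)
  qed
qed

lemma finite_col_classes: "finite (col_classes A m k)"
  by (simp add: col_classes_def)

lemma finite_col_class: "C \<in> col_classes A m k \<Longrightarrow> finite C"
  by (auto simp: col_classes_def)

lemma col_classes_disjoint:
  assumes "C \<in> col_classes A m k" "C' \<in> col_classes A m k" "C \<noteq> C'"
  shows "C \<inter> C' = {}"
proof (rule ccontr)
  assume "C \<inter> C' \<noteq> {}"
  then obtain l where "l \<in> C" "l \<in> C'"
    by blast
  with assms(1,2) obtain j j' where j: "C = {l. l < k \<and> col_equiv A m j l}" "col_equiv A m j l"
    and j': "C' = {l. l < k \<and> col_equiv A m j' l}" "col_equiv A m j' l"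
    unfolding col_classes_def by auto
  then have "col_equiv A m j j'" "col_equiv A m j' j"
    using col_equiv_trans col_equiv_sym by blast+
  then have "C = C'"
    unfolding j(1) j'(1) using col_equiv_trans by blast
  then show False
    using assms(3) by simp
qed

lemma col_classes_representatives:
  "\<exists>\<rho> \<kappa>. \<forall>C\<in>col_classes A m k. \<rho> C \<in> C \<and>
    (\<forall>j\<in>C. \<kappa> j \<noteq> 0 \<and> (\<forall>i<m. A i j = \<kappa> j * A i (\<rho> C)))"
proof -
  have "\<forall>C\<in>col_classes A m k. \<exists>l. l \<in> C"
    unfolding col_classes_def using col_equiv_refl by blast
  then obtain \<rho> where \<rho>: "\<forall>C\<in>col_classes A m k. \<rho> C \<in> C"
    by metis
  have equiv: "col_equiv A m j (\<rho> C)" if C: "C \<in> col_classes A m k" "j \<in> C" for C j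
  proof -
    obtain j0 where "C = {l. l < k \<and> col_equiv A m j0 l}"
      using C(1) unfolding col_classes_def by blast
    then have "col_equiv A m j0 j" "col_equiv A m j0 (\<rho> C)"
      using C \<rho> by auto
    then show ?thesis
      using col_equiv_trans col_equiv_sym by blast
  qed
  \<comment> \<open>Disjointness of the classes lets a single function of the column index carry the
    scalars of all classes.\<close>
  have "\<forall>j\<in>{..<k}. \<exists>c. c \<noteq> 0 \<and> (\<forall>C\<in>col_classes A m k. j \<in> C \<longrightarrow> (\<forall>i<m. A i j = c * A i (\<rho> C)))"
  proof
    fix j assume "j \<in> {..<k}"
    then obtain C where C: "C \<in> col_classes A m k" "j \<in> C"
      unfolding Union_col_classes[of A m k, symmetric] by blast
    then have "C' = C" if "C' \<in> col_classes A m k" "j \<in> C'" for C'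
      using col_classes_disjoint[of C A m k C'] that by blast
    moreover obtain c where "c \<noteq> 0" "\<forall>i<m. A i j = c * A i (\<rho> C)"
      using equiv[OF C] unfolding col_equiv_def by blast
    ultimately show "\<exists>c. c \<noteq> 0 \<and> (\<forall>C\<in>col_classes A m k. j \<in> C \<longrightarrow> (\<forall>i<m. A i j = c * A i (\<rho> C)))"
      by blast
  qed
  then obtain \<kappa> where \<kappa>: "\<forall>j\<in>{..<k}. \<kappa> j \<noteq> 0 \<and>
      (\<forall>C\<in>col_classes A m k. j \<in> C \<longrightarrow> (\<forall>i<m. A i j = \<kappa> j * A i (\<rho> C)))"
    by metis
  have "j \<in> {..<k}" if "C \<in> col_classes A m k" "j \<in> C" for C j
    using that unfolding Union_col_classes[of A m k, symmetric] by blast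
  then show ?thesis
    using \<rho> \<kappa> by (intro exI[of _ \<rho>] exI[of _ \<kappa>]) blast
qed

lemma sum_col_classes: "(\<Sum>j<k. f j) = (\<Sum>C\<in>col_classes A m k. \<Sum>j\<in>C. f j)"
proof -
  have "sum f (\<Union> (col_classes A m k)) = (sum \<circ> sum) f (col_classes A m k)"
    by (rule sum.Union_disjoint) (blast intro: finite_col_class, blast dest: col_classes_disjoint)
  then show ?thesis
    by (simp add: Union_col_classes)
qed

text \<open>The compressed system \<open>u\<close> has one column for each class and the y_C as a
  solution. Gluing makes any relation b of the points equal to \<tau>_C \<kappa>_j on each class;
  balancedness of b becomes the first premise of \<open>span\<close>, and the relation itself the
  second. The budget is the size of the span of the y_C times q^k for the coefficients of earlier
  points.\<close>

lemma exists_generic_solution: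
  fixes A :: "nat \<Rightarrow> nat \<Rightarrow> 'a::{field,finite}" and m k :: nat and y :: "nat set \<Rightarrow> nat \<Rightarrow> 'a"
  defines "\<C> \<equiv> col_classes A m k"
  assumes u: "\<And>C i j. C \<in> \<C> \<Longrightarrow> j \<in> C \<Longrightarrow> i < m \<Longrightarrow> A i j = \<kappa> j * u i C"
    and rel: "\<And>i t. i < m \<Longrightarrow> (\<Sum>C\<in>\<C>. y C t * u i C) = 0"
    and span: "\<And>\<tau>. (\<Sum>C\<in>\<C>. \<tau> C * sum \<kappa> C) = 0 \<Longrightarrow> \<forall>t. (\<Sum>C\<in>\<C>. y C t * \<tau> C) = 0 \<Longrightarrow>
      in_span_rows {..<m} \<C> u \<tau>"
    and rep: "\<And>C. C \<in> \<C> \<Longrightarrow> generically_representable S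
      (card (UNIV :: 'a set) ^ card \<C> * card (UNIV :: 'a set) ^ k) C \<kappa> (y C)"
  shows "\<exists>x. (\<forall>j<k. x j \<in> S) \<and> is_solution A m k x \<and> is_generic A m k x"
proof -
  have U: "\<Union>\<C> = {..<k}"
    unfolding \<C>_def by (rule Union_col_classes)
  have fin: "finite \<C>"
    unfolding \<C>_def by (rule finite_col_classes)
  have split: "(\<Sum>j<k. f j) = (\<Sum>C\<in>\<C>. \<Sum>j\<in>C. f j)" for f :: "nat \<Rightarrow> 'a"
    unfolding \<C>_def by (rule sum_col_classes)
  define Y where "Y = (\<lambda>\<tau> t. \<Sum>C\<in>\<C>. \<tau> C * y C t) ` PiE \<C> (\<lambda>_. UNIV)"
  have finP: "finite (PiE \<C> (\<lambda>_. UNIV :: 'a set))"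
    using fin by (simp add: finite_PiE)
  have finY: "finite Y"
    unfolding Y_def using finP by (rule finite_imageI)
  have cY: "card Y \<le> card (UNIV :: 'a set) ^ card \<C>"
    using card_image_le[OF finP, of "\<lambda>\<tau> t. \<Sum>C\<in>\<C>. \<tau> C * y C t"] fin by (simp add: Y_def card_PiE)
  have "\<exists>x. (\<forall>j\<in>\<Union>\<C>. x j \<in> S) \<and> (\<forall>C\<in>\<C>. lin_comb C \<kappa> x = y C) \<and>
    (\<forall>b. lin_comb (\<Union>\<C>) b x \<in> Y \<longrightarrow> (\<forall>C\<in>\<C>. \<exists>r. \<forall>j\<in>C. b j = r * \<kappa> j))"
  proof (rule generically_representable_glue[OF fin _ _ finY _ _ rep])
    show "finite C" if "C \<in> \<C>" for C
      using that finite_col_class unfolding \<C>_def by blast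
    show "C \<inter> C' = {}" if "C \<in> \<C>" "C' \<in> \<C>" "C \<noteq> C'" for C C'
      using that col_classes_disjoint unfolding \<C>_def by blast
    show "card Y * card (UNIV :: 'a set) ^ card (\<Union>\<C>) \<le> card (UNIV :: 'a set) ^ card \<C> * card (UNIV :: 'a set) ^ k"
      using cY by (simp add: U)
    fix C v r assume C: "C \<in> \<C>" and "v \<in> Y"
    then obtain \<tau> where \<tau>: "\<tau> \<in> PiE \<C> (\<lambda>_. UNIV)" "v = (\<lambda>t. \<Sum>C\<in>\<C>. \<tau> C * y C t)"
      unfolding Y_def by blast
    let ?\<tau> = "\<tau>(C := \<tau> C - r)"
    have "(\<lambda>t. v t - r * y C t) = (\<lambda>t. \<Sum>C\<in>\<C>. ?\<tau> C * y C t)"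
    proof
      fix t
      have "(\<Sum>C'\<in>\<C> - {C}. ?\<tau> C' * y C' t) = (\<Sum>C'\<in>\<C> - {C}. \<tau> C' * y C' t)"
        by (intro sum.cong) auto
      then show "v t - r * y C t = (\<Sum>C\<in>\<C>. ?\<tau> C * y C t)"
        unfolding \<tau>(2) using C fin by (simp add: sum.remove[of \<C> C] left_diff_distrib)
    qed
    moreover have "?\<tau> \<in> PiE \<C> (\<lambda>_. UNIV)"
      using \<tau>(1) C by (auto simp: PiE_def extensional_def)
    ultimately show "(\<lambda>t. v t - r * y C t) \<in> Y"
      unfolding Y_def by (rule image_eqI)
  qed
  then obtain x where x: "\<forall>j<k. x j \<in> S" "\<forall>C\<in>\<C>. lin_comb C \<kappa> x = y C"
      "\<And>b. lin_comb {..<k} b x \<in> Y \<Longrightarrow> \<forall>C\<in>\<C>. \<exists>r. \<forall>j\<in>C. b j = r * \<kappa> j"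
    unfolding U by auto
  have lc: "(\<Sum>j\<in>C. \<kappa> j * x j t) = y C t" if "C \<in> \<C>" for C t
    using fun_cong[OF x(2)[rule_format, OF that], of t] by (simp add: lin_comb_def)
  have "is_solution A m k x"
    unfolding is_solution_def
  proof (intro allI impI)
    fix i t assume i: "i < m"
    have "(\<Sum>j<k. A i j * x j t) = (\<Sum>C\<in>\<C>. \<Sum>j\<in>C. A i j * x j t)"
      by (rule split)
    also have "\<dots> = (\<Sum>C\<in>\<C>. \<Sum>j\<in>C. u i C * (\<kappa> j * x j t))"
      using u i by (intro sum.cong refl) (simp add: mult_ac)
    also have "\<dots> = (\<Sum>C\<in>\<C>. y C t * u i C)"
      by (intro sum.cong refl) (simp add: lc mult.commute flip: sum_distrib_left)
    finally show "(\<Sum>j<k. A i j * x j t) = 0"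
      using rel[OF i] by simp
  qed
  moreover have "is_generic A m k x"
    unfolding is_generic_def
  proof (intro allI impI)
    fix b assume b: "(\<Sum>j<k. b j) = 0 \<and> (\<forall>t. (\<Sum>j<k. b j * x j t) = 0)"
    \<comment> \<open>A relation has value 0, which belongs to \<open>Y\<close> with zero
      coefficients; \<open>restrict\<close> makes these an element of \<open>PiE\<close>.\<close>
    then have "lin_comb {..<k} b x = (\<lambda>t. \<Sum>C\<in>\<C>. restrict (\<lambda>_. 0) \<C> C * y C t)"
      by (simp add: lin_comb_def)
    then have "lin_comb {..<k} b x \<in> Y"
      unfolding Y_def by (rule image_eqI[where x = "restrict (\<lambda>_. 0) \<C>"]) simp
    then obtain \<tau> where \<tau>: "\<forall>C\<in>\<C>. \<forall>j\<in>C. b j = \<tau> C * \<kappa> j"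
      using x(3) by metis
    have "(\<Sum>C\<in>\<C>. \<tau> C * sum \<kappa> C) = (\<Sum>j<k. b j)"
      unfolding split sum_distrib_left using \<tau> by (intro sum.cong) auto
    moreover have "(\<Sum>C\<in>\<C>. y C t * \<tau> C) = 0" for t
    proof -
      have "(\<Sum>C\<in>\<C>. y C t * \<tau> C) = (\<Sum>C\<in>\<C>. \<Sum>j\<in>C. \<tau> C * (\<kappa> j * x j t))"
        by (intro sum.cong refl) (simp add: lc mult.commute flip: sum_distrib_left)
      also have "\<dots> = (\<Sum>j<k. b j * x j t)"
        unfolding split using \<tau> by (intro sum.cong) (auto simp: mult.assoc)
      finally show ?thesis
        using b by simp
    qed
    ultimately obtain c where c: "\<forall>C\<in>\<C>. \<tau> C = (\<Sum>i<m. c i * u i C)"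
      using span[of \<tau>] b unfolding in_span_rows_def by auto
    have "b j = (\<Sum>i<m. c i * A i j)" if j: "j < k" for j
    proof -
      obtain C where C: "C \<in> \<C>" "j \<in> C"
        using U j by blast
      have "(\<Sum>i<m. c i * A i j) = (\<Sum>i<m. c i * u i C * \<kappa> j)"
        using u[OF C] by (intro sum.cong) auto
      then show ?thesis
        using \<tau> c C by (simp add: sum_distrib_right)
    qed
    then show "in_rowspan A m k b"
      unfolding in_rowspan_def by blast
  qed
  ultimately show ?thesis
    using x(1) by blast
qed

lemma independent_rows_col_classes:
  assumes "non_degenerate A m k"
    and "\<And>C i j. C \<in> col_classes A m k \<Longrightarrow> j \<in> C \<Longrightarrow> i < m \<Longrightarrow> A i j = \<kappa> j * u i C"
  shows "independent_rows {..<m} (col_classes A m k) u"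
  unfolding independent_rows_def
proof (intro allI impI)
  fix c assume c: "\<forall>C\<in>col_classes A m k. (\<Sum>i<m. c i * u i C) = 0"
  have "(\<Sum>i<m. c i * A i j) = 0" if j: "j < k" for j
  proof -
    obtain C where C: "C \<in> col_classes A m k" "j \<in> C"
      using Union_col_classes[of A m k] j by blast
    have "(\<Sum>i<m. c i * A i j) = (\<Sum>i<m. \<kappa> j * (c i * u i C))"
      using assms(2)[OF C] by (intro sum.cong) auto
    also have "\<dots> = \<kappa> j * (\<Sum>i<m. c i * u i C)"
      by (rule sum_distrib_left[symmetric])
    finally show ?thesis
      using c C by simp
  qed
  then have "\<forall>i<m. c i = 0"
    using assms(1) unfolding non_degenerate_def by blast
  then show "\<forall>i\<in>{..<m}. c i = 0"
    by simp
qed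

section \<open>The two cases of the theorem\<close>

lemma almost_all_large:
  fixes R :: "(nat \<Rightarrow> 'a::{field,finite}) set \<Rightarrow> (nat \<Rightarrow> 'a) \<Rightarrow> bool"
  assumes "almost_all R"
  shows "\<exists>\<beta> \<gamma>::real. 0 < \<beta> \<and> 0 < \<gamma> \<and> \<gamma> < real (card (UNIV :: 'a set)) \<and>
    (\<forall>n S. S \<subseteq> vecs n \<and> \<beta> * \<gamma> ^ n \<le> real (card S) \<longrightarrow> (\<exists>y\<in>S. R S y))"
proof -
  obtain B \<gamma> :: real where *: "0 \<le> B" "0 < \<gamma>" "\<gamma> < real (card (UNIV :: 'a set))"
    "\<And>n S. S \<subseteq> vecs n \<Longrightarrow> real (card {y\<in>S. \<not> R S y}) \<le> B * \<gamma> ^ n"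
    using assms unfolding almost_all_def by blast
  \<comment> \<open>\<open>B + 1\<close> in place of \<open>B\<close>: strictly more points than can
    be exceptional, and a positive constant even for \<open>B = 0\<close>.\<close>
  have "\<exists>y\<in>S. R S y" if S: "S \<subseteq> vecs n" "(B + 1) * \<gamma> ^ n \<le> real (card S)" for n S
  proof (rule ccontr)
    assume "\<not> ?thesis"
    then have "{y\<in>S. \<not> R S y} = S"
      by blast
    then have "(B + 1) * \<gamma> ^ n \<le> B * \<gamma> ^ n"
      using *(4)[OF S(1)] S(2) by simp
    then show False
      using *(2) by (simp add: distrib_right) (metis not_less zero_less_power)
  qed
  then show ?thesis
    using * by (intro exI[of _ "B + 1"] exI[of _ \<gamma>]) auto
qed

text \<open>Balancedness puts the vector of class sums \<open>\<sigma>\<close> into the kernel of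
  the compressed system, which has m independent rows and m + 1 columns. A \<tau> orthogonal to
  \<open>\<sigma>\<close> but outside the row span would complete the rows to a square independent
  system with the nonzero kernel vector \<open>\<sigma>\<close>.\<close>

lemma temperate_of_no_sum_zero_class:
  fixes A :: "nat \<Rightarrow> nat \<Rightarrow> 'a::{field,finite}"
  assumes bal: "balanced_sys A m k" and nondeg: "non_degenerate A m k"
    and nz: "\<forall>C\<in>col_classes A m k. \<not> class_sums_zero A m C"
    and card: "card (col_classes A m k) = m + 1"
  shows "temperate A m k"
proof -
  define \<C> where "\<C> = col_classes A m k"
  have fin: "finite \<C>" "\<And>C. C \<in> \<C> \<Longrightarrow> finite C"
    unfolding \<C>_def by (rule finite_col_classes, rule finite_col_class)
  obtain \<rho> \<kappa> where \<kappa>: "\<And>C j. C \<in> \<C> \<Longrightarrow> j \<in> C \<Longrightarrow> \<kappa> j \<noteq> 0"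
    and A: "\<And>C i j. C \<in> \<C> \<Longrightarrow> j \<in> C \<Longrightarrow> i < m \<Longrightarrow> A i j = \<kappa> j * A i (\<rho> C)"
    using col_classes_representatives[of A m k] unfolding \<C>_def[symmetric] by metis
  define u where "u = (\<lambda>i C. A i (\<rho> C))"
  have u: "A i j = \<kappa> j * u i C" if "C \<in> \<C>" "j \<in> C" "i < m" for C i j
    unfolding u_def using that by (rule A)
  have indep: "independent_rows {..<m} \<C> u"
    unfolding \<C>_def by (rule independent_rows_col_classes[OF nondeg]) (rule u[unfolded \<C>_def])
  define \<sigma> where "\<sigma> = (\<lambda>C. sum \<kappa> C)"
  have sumA: "(\<Sum>j\<in>C. A i j) = \<sigma> C * u i C" if "C \<in> \<C>" "i < m" for C i
    unfolding \<sigma>_def sum_distrib_right using u that by (intro sum.cong) auto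
  have \<sigma>: "\<sigma> C \<noteq> 0" if "C \<in> \<C>" for C
  proof
    assume "\<sigma> C = 0"
    then have "class_sums_zero A m C"
      using sumA[OF that] by (simp add: class_sums_zero_def)
    then show False
      using nz that by (simp add: \<C>_def)
  qed
  have \<sigma>_ker: "(\<Sum>C\<in>\<C>. \<sigma> C * u i C) = 0" if "i < m" for i
  proof -
    have "(\<Sum>C\<in>\<C>. \<sigma> C * u i C) = (\<Sum>C\<in>\<C>. \<Sum>j\<in>C. A i j)"
      by (intro sum.cong refl) (simp only: sumA that)
    also have "\<dots> = (\<Sum>j<k. A i j)"
      unfolding \<C>_def by (rule sum_col_classes[symmetric])
    finally show ?thesis
      using bal that by (simp add: balanced_sys_def)
  qed
  have span: "in_span_rows {..<m} \<C> u \<tau>" if \<tau>: "(\<Sum>C\<in>\<C>. \<tau> C * \<sigma> C) = 0" for \<tau>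
  proof (rule ccontr)
    assume "\<not> ?thesis"
    then have ind: "independent_rows (insert None (Some ` {..<m})) \<C> (case_option \<tau> u)"
      by (intro independent_rows_insert indep) simp
    have "card \<C> \<noteq> 0"
      using card by (simp add: \<C>_def)
    then obtain C where C: "C \<in> \<C>"
      by (metis card.empty ex_in_conv)
    have "\<sigma> C = 0"
    proof (rule independent_rows_square_kernel[where w = \<sigma>, OF _ fin(1) ind _ _ C])
      show "card \<C> \<le> card (insert None (Some ` {..<m}))"
        using card card_option_index[of "{..<m}"] by (simp add: \<C>_def)
      fix i assume "i \<in> insert None (Some ` {..<m})"
      then show "(\<Sum>x\<in>\<C>. \<sigma> x * case_option \<tau> u i x) = 0"
        using \<tau> \<sigma>_ker by (cases i) (auto simp: mult.commute)
    qed simp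
    then show False
      using \<sigma> C by blast
  qed
  define Q where "Q = card (UNIV :: 'a set) ^ card \<C> * card (UNIV :: 'a set) ^ k"
  have "almost_all (\<lambda>S y. \<forall>C\<in>\<C>. generically_representable S Q C (\<lambda>j. \<kappa> j / \<sigma> C) y)"
  proof (rule almost_all_Ball[OF fin(1)])
    fix C assume C: "C \<in> \<C>"
    show "almost_all (\<lambda>S y. generically_representable S Q C (\<lambda>j. \<kappa> j / \<sigma> C) y)"
    proof (rule almost_all_generically_representable[OF fin(2)[OF C]])
      show "(\<Sum>j\<in>C. \<kappa> j / \<sigma> C) = 1"
        using \<sigma>[OF C] by (simp add: \<sigma>_def flip: sum_divide_distrib)
    qed (use C \<kappa> \<sigma> in simp)
  next
    fix C S S' y assume "generically_representable S Q C (\<lambda>j. \<kappa> j / \<sigma> C) y" "S \<subseteq> S'"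
    then show "generically_representable S' Q C (\<lambda>j. \<kappa> j / \<sigma> C) y"
      by (rule generically_representable_mono) simp
  qed
  from almost_all_large[OF this] obtain \<beta> \<gamma> :: real
    where \<beta>: "0 < \<beta>" "0 < \<gamma>" "\<gamma> < real (card (UNIV :: 'a set))"
      and large: "\<And>n S. S \<subseteq> vecs n \<Longrightarrow> \<beta> * \<gamma> ^ n \<le> real (card S) \<Longrightarrow>
        \<exists>y\<in>S. \<forall>C\<in>\<C>. generically_representable S Q C (\<lambda>j. \<kappa> j / \<sigma> C) y"
    by blast
  have "\<exists>x. (\<forall>j<k. x j \<in> S) \<and> is_solution A m k x \<and> is_generic A m k x"
    if S: "S \<subseteq> vecs n" "\<beta> * \<gamma> ^ n \<le> real (card S)" for n S
  proof -
    obtain y where y: "\<And>C. C \<in> \<C> \<Longrightarrow> generically_representable S Q C (\<lambda>j. \<kappa> j / \<sigma> C) y"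
      using large[OF S] by blast
    show ?thesis
    proof (rule exists_generic_solution[where A = A and m = m and k = k and \<kappa> = \<kappa> and u = u and y = "\<lambda>C t. \<sigma> C * y t", folded \<C>_def])
      show "A i j = \<kappa> j * u i C" if "C \<in> \<C>" "j \<in> C" "i < m" for C i j
        using that by (rule u)
      show "(\<Sum>C\<in>\<C>. \<sigma> C * y t * u i C) = 0" if "i < m" for i t
      proof -
        have "(\<Sum>C\<in>\<C>. \<sigma> C * y t * u i C) = (\<Sum>C\<in>\<C>. \<sigma> C * u i C) * y t"
          unfolding sum_distrib_right by (intro sum.cong refl) (simp only: mult_ac)
        then show ?thesis
          using \<sigma>_ker[OF that] by simp
      qed
      show "in_span_rows {..<m} \<C> u \<tau>" if "(\<Sum>C\<in>\<C>. \<tau> C * sum \<kappa> C) = 0" for \<tau>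
        using that by (intro span) (simp add: \<sigma>_def)
      show "generically_representable S (card (UNIV :: 'a set) ^ card \<C> * card (UNIV :: 'a set) ^ k) C \<kappa> (\<lambda>t. \<sigma> C * y t)"
        if "C \<in> \<C>" for C
        unfolding Q_def[symmetric] using \<sigma>[OF that] y[OF that] by (rule generically_representable_scale)
    qed
  qed
  then show ?thesis
    unfolding temperate_def using \<beta> by (intro exI[of _ \<beta>] exI[of _ \<gamma>]) auto
qed

text \<open>The root \<delta> is the break-even point: \<delta>^(2 l) = q^(2 l - 1), so a set of
  size \<delta>^n satisfies s^(2 l) q^n = q^(2 l n). The factor \<open>K + 1\<close> makes the
  inequality strict with \<open>K\<close> in front.\<close>

lemma popular_difference_threshold:
  fixes q K l n s :: nat and \<gamma> :: real
  assumes q: "2 \<le> q" and l: "0 < l" and \<gamma>: "root (2 * l) (real q ^ (2 * l - 1)) \<le> \<gamma>"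
    and s: "real (K + 1) * \<gamma> ^ n \<le> real s"
  shows "K < s" "K * (q ^ n) ^ (2 * l) < s ^ (2 * l) * q ^ n"
proof -
  define \<delta> where "\<delta> = root (2 * l) (real q ^ (2 * l - 1))"
  have \<delta>: "1 \<le> \<delta>" "\<delta> ^ (2 * l) = real q ^ (2 * l - 1)"
    using q l by (auto simp: \<delta>_def)
  have "real (K + 1) * \<delta> ^ n \<le> real (K + 1) * \<gamma> ^ n"
    using \<delta>(1) \<gamma> by (intro mult_left_mono power_mono) (auto simp: \<delta>_def)
  then have s': "real (K + 1) * \<delta> ^ n \<le> real s"
    using s by linarith
  have "real (K + 1) * 1 \<le> real (K + 1) * \<delta> ^ n"
    using \<delta>(1) by (intro mult_left_mono one_le_power) auto
  then show "K < s"
    using s' by (simp only: mult_1_right)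
  have "real (K + 1) * (\<delta> ^ n) ^ (2 * l) \<le> real (K + 1) ^ (2 * l) * (\<delta> ^ n) ^ (2 * l)"
    using l \<delta>(1) by (intro mult_right_mono self_le_power) auto
  also have "\<dots> \<le> real s ^ (2 * l)"
    unfolding power_mult_distrib[symmetric] using s' \<delta>(1) by (intro power_mono) auto
  finally have *: "real (K + 1) * (\<delta> ^ n) ^ (2 * l) \<le> real s ^ (2 * l)" .
  have "(\<delta> ^ n) ^ (2 * l) = (real q ^ n) ^ (2 * l - 1)"
    using \<delta>(2) by (metis power_mult mult.commute)
  then have "real (K + 1) * (real q ^ n) ^ (2 * l - 1) * real q ^ n \<le> real s ^ (2 * l) * real q ^ n"
    using * by (intro mult_right_mono) auto
  moreover have "(real q ^ n) ^ (2 * l - 1) * real q ^ n = (real q ^ n) ^ (2 * l)"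
    using l by (subst power_Suc2[symmetric]) simp
  ultimately have "real (K + 1) * (real q ^ n) ^ (2 * l) \<le> real s ^ (2 * l) * real q ^ n"
    by (simp only: mult.assoc)
  then have "real ((K + 1) * (q ^ n) ^ (2 * l)) \<le> real (s ^ (2 * l) * q ^ n)"
    by (simp only: of_nat_mult of_nat_power)
  then have "(K + 1) * (q ^ n) ^ (2 * l) \<le> s ^ (2 * l) * q ^ n"
    by (simp only: of_nat_le_iff)
  moreover have "K * (q ^ n) ^ (2 * l) < (K + 1) * (q ^ n) ^ (2 * l)"
    using q by simp
  ultimately show "K * (q ^ n) ^ (2 * l) < s ^ (2 * l) * q ^ n"
    by linarith
qed

text \<open>After discarding the exceptional points, popular differences are sought among the good
  points only, because in y_C = a - a' the point a' must be abundantly represented by the class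
  without its representative.\<close>

lemma temperate_of_sum_zero_classes:
  fixes A :: "nat \<Rightarrow> nat \<Rightarrow> 'a::{field,finite}"
  assumes nondeg: "non_degenerate A m k"
    and zero: "\<forall>C\<in>col_classes A m k. class_sums_zero A m C"
    and k: "0 < k"
  shows "temperate A m k"
proof -
  define q where "q = card (UNIV :: 'a set)"
  have q: "2 \<le> q"
    unfolding q_def by (rule card_field_ge_2)
  define \<C> where "\<C> = col_classes A m k"
  define l where "l = card \<C>"
  have fin: "finite \<C>" "\<And>C. C \<in> \<C> \<Longrightarrow> finite C"
    unfolding \<C>_def by (rule finite_col_classes, rule finite_col_class)
  have "\<C> \<noteq> {}"
    using Union_col_classes[of A m k] k by (auto simp: \<C>_def)
  then have l: "0 < l"
    using fin by (simp add: l_def card_gt_0_iff)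
  obtain \<rho> \<kappa> where \<rho>: "\<And>C. C \<in> \<C> \<Longrightarrow> \<rho> C \<in> C"
    and \<kappa>: "\<And>C j. C \<in> \<C> \<Longrightarrow> j \<in> C \<Longrightarrow> \<kappa> j \<noteq> 0"
    and A: "\<And>C i j. C \<in> \<C> \<Longrightarrow> j \<in> C \<Longrightarrow> i < m \<Longrightarrow> A i j = \<kappa> j * A i (\<rho> C)"
    using col_classes_representatives[of A m k] unfolding \<C>_def[symmetric] by metis
  define u where "u = (\<lambda>i C. A i (\<rho> C))"
  have u: "A i j = \<kappa> j * u i C" if "C \<in> \<C>" "j \<in> C" "i < m" for C i j
    unfolding u_def using that by (rule A)
  have indep: "independent_rows {..<m} \<C> u"
    unfolding \<C>_def by (rule independent_rows_col_classes[OF nondeg]) (rule u[unfolded \<C>_def])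
  have u_nz: "\<exists>i<m. u i C \<noteq> 0" if "C \<in> \<C>" for C
  proof -
    have "\<rho> C < k"
      using \<rho>[OF that] that Union_col_classes[of A m k] by (auto simp: \<C>_def)
    then show ?thesis
      using nondeg by (simp add: non_degenerate_def u_def)
  qed
  \<comment> \<open>Columns are nonzero, so the scalar relating the representative to itself must be
    1.\<close>
  have \<kappa>\<rho>: "\<kappa> (\<rho> C) = 1" if C: "C \<in> \<C>" for C
  proof -
    obtain i where i: "i < m" "u i C \<noteq> 0"
      using u_nz[OF C] by blast
    have "u i C = \<kappa> (\<rho> C) * u i C"
      using u[OF C \<rho>[OF C] i(1)] by (simp only: u_def)
    then show ?thesis
      using i(2) by (simp only: mult_cancel_right1) simp
  qed
  have \<sigma>: "sum \<kappa> C = 0" if C: "C \<in> \<C>" for C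
  proof -
    obtain i where i: "i < m" "u i C \<noteq> 0"
      using u_nz[OF C] by blast
    have "sum \<kappa> C * u i C = (\<Sum>j\<in>C. A i j)"
      unfolding sum_distrib_right using u C i by (intro sum.cong) auto
    also have "\<dots> = 0"
      using zero C i by (simp add: class_sums_zero_def \<C>_def)
    finally show ?thesis
      using i by simp
  qed
  define Q where "Q = q ^ card \<C> * q ^ k"
  \<comment> \<open>With \<open>\<kappa> (\<rho> C) = 1\<close> and class sum zero, the remaining
    coefficients with reversed sign have sum 1.\<close>
  define R where "R = (\<lambda>S y. \<forall>C\<in>\<C>. generically_representable S (Q * q) (C - {\<rho> C}) (\<lambda>j. - \<kappa> j) y)"
  have "almost_all R"
    unfolding R_def
  proof (rule almost_all_Ball[OF fin(1)])
    fix C assume C: "C \<in> \<C>"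
    show "almost_all (\<lambda>S y. generically_representable S (Q * q) (C - {\<rho> C}) (\<lambda>j. - \<kappa> j) y)"
    proof (rule almost_all_generically_representable)
      have "sum \<kappa> C = \<kappa> (\<rho> C) + sum \<kappa> (C - {\<rho> C})"
        using fin(2)[OF C] \<rho>[OF C] by (rule sum.remove)
      then have "sum \<kappa> (C - {\<rho> C}) = - 1"
        using \<sigma>[OF C] \<kappa>\<rho>[OF C] by (simp add: eq_neg_iff_add_eq_0 add.commute)
      then show "(\<Sum>j\<in>C - {\<rho> C}. - \<kappa> j) = 1"
        by (simp add: sum_negf)
    qed (use C \<kappa> fin in auto)
  next
    fix C S S' y assume "generically_representable S (Q * q) (C - {\<rho> C}) (\<lambda>j. - \<kappa> j) y" "S \<subseteq> S'"
    then show "generically_representable S' (Q * q) (C - {\<rho> C}) (\<lambda>j. - \<kappa> j) y"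
      by (rule generically_representable_mono) simp
  qed
  then obtain B \<gamma>1 :: real where B: "0 \<le> B" "0 < \<gamma>1" "\<gamma>1 < real q"
    "\<And>n S. S \<subseteq> vecs n \<Longrightarrow> real (card {y\<in>S. \<not> R S y}) \<le> B * \<gamma>1 ^ n"
    unfolding almost_all_def q_def by blast
  define h where "h = Q * (q * q)"
  \<comment> \<open>\<open>h\<close> is the number of points that may have to be avoided, and q^l
    accounts for the conditions that make a solution non-generic.\<close>
  define K where "K = h + q ^ l"
  define \<gamma>2 where "\<gamma>2 = root (2 * l) (real q ^ (2 * l - 1))"
  have \<gamma>2: "\<gamma>2 < real q"
  proof -
    have "real q ^ (2 * l - 1) < real q ^ (2 * l)"
      using q l by (intro power_strict_increasing) auto
    then have "\<gamma>2 < root (2 * l) (real q ^ (2 * l))"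
      unfolding \<gamma>2_def using l by (intro real_root_less_mono) auto
    then show ?thesis
      using l by (simp add: real_root_power_cancel)
  qed
  define \<gamma> where "\<gamma> = max \<gamma>1 \<gamma>2"
  \<comment> \<open>\<open>B\<close> pays for the exceptional points; \<open>K + 1\<close> is what
    the threshold requires of the good points that remain.\<close>
  define \<beta> where "\<beta> = B + real (K + 1)"
  have "\<exists>x. (\<forall>j<k. x j \<in> S) \<and> is_solution A m k x \<and> is_generic A m k x"
    if S: "S \<subseteq> vecs n" "\<beta> * \<gamma> ^ n \<le> real (card S)" for n S
  proof -
    define S' where "S' = {y\<in>S. R S y}"
    have S': "S' \<subseteq> vecs n"
      using S by (auto simp: S'_def)
    have finS: "finite S"
      using S finite_vecs finite_subset by blast
    have "card S = card S' + card {y\<in>S. \<not> R S y}"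
      using finS by (subst card_Un_disjoint[symmetric]) (auto simp: S'_def intro!: arg_cong[where f = card])
    moreover have "B * \<gamma>1 ^ n \<le> B * \<gamma> ^ n"
      using B by (intro mult_left_mono power_mono) (auto simp: \<gamma>_def)
    ultimately have "real (K + 1) * \<gamma> ^ n \<le> real (card S')"
      using B(4)[OF S(1)] S(2) by (simp add: \<beta>_def distrib_right)
    then have K: "K < card S'" "K * (q ^ n) ^ (2 * l) < card S' ^ (2 * l) * q ^ n"
      using popular_difference_threshold[OF q l, of \<gamma> K n "card S'"] by (auto simp: \<gamma>_def \<gamma>2_def)
    have "h < card S'"
      using K(1) by (simp add: K_def)
    then obtain z where z1: "\<forall>i\<in>{..<m}. \<forall>t. (\<Sum>C\<in>\<C>. z C t * u i C) = 0"
      and z2: "\<forall>b. (\<forall>t. (\<Sum>C\<in>\<C>. z C t * b C) = 0) \<longrightarrow> in_span_rows {..<m} \<C> u b"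
      and z3: "\<forall>C\<in>\<C>. \<forall>H. finite H \<and> card H \<le> h \<longrightarrow> (\<exists>a\<in>S' - H. (\<lambda>t. a t - z C t) \<in> S')"
      using generic_popular_difference[OF _ fin(1) indep S', of h] K(2)
      unfolding K_def l_def q_def by blast
    show ?thesis
    proof (rule exists_generic_solution[where A = A and m = m and k = k and \<kappa> = \<kappa> and u = u and y = z, folded \<C>_def])
      show "A i j = \<kappa> j * u i C" if "C \<in> \<C>" "j \<in> C" "i < m" for C i j
        using that by (rule u)
      show "(\<Sum>C\<in>\<C>. z C t * u i C) = 0" if "i < m" for i t
        using z1 that by simp
      show "in_span_rows {..<m} \<C> u \<tau>" if "\<forall>t. (\<Sum>C\<in>\<C>. z C t * \<tau> C) = 0" for \<tau>
        using z2 that by blast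
      show "generically_representable S (card (UNIV :: 'a set) ^ card \<C> * card (UNIV :: 'a set) ^ k) C \<kappa> (z C)"
        if C: "C \<in> \<C>" for C
      proof -
        have "generically_representable S Q C \<kappa> (z C)"
        proof (rule generically_representable_sum_zero[where \<kappa> = \<kappa> and C = C and \<rho> = "\<rho> C", OF fin(2)[OF C] \<rho>[OF C] \<kappa>\<rho>[OF C], folded q_def])
          fix H :: "(nat \<Rightarrow> 'a) set"
          assume "finite H" "card H \<le> Q * (q * q)"
          then obtain a where "a \<in> S' - H" "(\<lambda>t. a t - z C t) \<in> S'"
            using z3 C unfolding h_def by blast
          then show "\<exists>a\<in>S - H. generically_representable S (Q * q) (C - {\<rho> C}) (\<lambda>j. - \<kappa> j) (\<lambda>t. a t - z C t)"
            using C unfolding S'_def R_def by blast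
        qed
        then show ?thesis
          by (simp add: Q_def q_def)
      qed
    qed
  qed
  moreover have "0 < \<beta>" "0 < \<gamma>" "\<gamma> < real (card (UNIV :: 'a set))"
    using B \<gamma>2 by (auto simp: \<beta>_def \<gamma>_def q_def)
  ultimately show ?thesis
    unfolding temperate_def by (intro exI[of _ \<beta>] exI[of _ \<gamma>]) auto
qed

lemma temperate_no_variables:
  fixes A :: "nat \<Rightarrow> nat \<Rightarrow> 'a::{field,finite}"
  shows "temperate A m 0"
proof -
  have "1 < real (card (UNIV :: 'a set))"
    using card_field_ge_2[where 'a = 'a] by simp
  then show ?thesis
    unfolding temperate_def
    by (intro exI[of _ 1] exI[of _ 1]) (simp add: is_solution_def is_generic_def in_rowspan_def)
qed

theorem theoremB:
  fixes A :: "nat \<Rightarrow> nat \<Rightarrow> 'a::{field,finite}" and m k :: nat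
  assumes "type_RC A m k"
    and "non_degenerate A m k"
    and "irreducible_sys A m k"
    and "((\<forall>C\<in>col_classes A m k. \<not> class_sums_zero A m C) \<and> card (col_classes A m k) = m + 1)
         \<or> (\<forall>C\<in>col_classes A m k. class_sums_zero A m C)"
  shows "temperate A m k"
proof -
  have "balanced_sys A m k"
    using assms(1) by (simp add: type_RC_def)
  \<comment> \<open>The system without variables is treated apart, since the root of order 2 l
    presupposes at least one class.\<close>
  then show ?thesis
    using assms(2,4) temperate_of_no_sum_zero_class temperate_of_sum_zero_classes temperate_no_variables
    by (metis gr0I)
qed

end
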